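(* Let $X$ be a curve over a finite field, $P$ a rational point and $C$ a divisor. For every divisor $B$, \[ \gamma_P(C)\geq\#\Delta_P(B,C)\qquad\text{and}\qquad\gamma_P(-C)\geq\#\Delta_P(B-C,-C), \] and these two bounds are equivalent.
   Context: $L(E)=\{f:(f)+E\ge0\}\cup\{0\}$; $\Gamma_P$ is the set of divisor classes $A$ with $L(A)\ne L(A-P)$; $\Gamma_P(C)=\{A\in\Gamma_P: A-C\in\Gamma_P\}$ and $\gamma_P(C)=\min\{\deg A:A\in\Gamma_P(C)\}$. $\Delta_P(B,C)=\{B+iP : i\in\mathbb{Z},\ B+iP\in\Gamma_P,\ B-C+iP\notin\Gamma_P\}$. *)

theory Defs
  imports
    "HOL-Library.Poly_Mapping"
    "HOL-Library.FuncSet"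
    "HOL-Computational_Algebra.Polynomial"
begin

text \<open>
  A (smooth, projective, absolutely irreducible) curve over a finite field \<open>k\<close> is given by its
  function field \<open>'a\<close> together with the embedding \<open>\<iota>\<close> of the constants \<open>k\<close>: its points are the
  discrete valuations of the function field over \<open>k\<close> (the abstract nonsingular curve of the
  function field).
\<close>

definition field_embedding :: "('k::field \<Rightarrow> 'a::field) \<Rightarrow> bool" where
  "field_embedding \<iota> \<longleftrightarrow>
     \<iota> 1 = 1 \<and> (\<forall>x y. \<iota> (x + y) = \<iota> x + \<iota> y) \<and> (\<forall>x y. \<iota> (x * y) = \<iota> x * \<iota> y)"

definition algebraic_over :: "('k::field \<Rightarrow> 'a::field) \<Rightarrow> 'a \<Rightarrow> bool" where
  "algebraic_over \<iota> x \<longleftrightarrow> (\<exists>p. p \<noteq> 0 \<and> poly (map_poly \<iota> p) x = 0)"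

definition simple_field_extension :: "('k::field \<Rightarrow> 'a::field) \<Rightarrow> 'a \<Rightarrow> 'a set" where
  "simple_field_extension \<iota> x =
     {poly (map_poly \<iota> p) x / poly (map_poly \<iota> q) x |p q. poly (map_poly \<iota> q) x \<noteq> 0}"

text \<open>
  The last clause says that the constant field is algebraically closed in the function field;
  over a perfect field this is absolute irreducibility of the curve.
\<close>

definition curve :: "('k::{field,finite} \<Rightarrow> 'a::field) \<Rightarrow> bool" where
  "curve \<iota> \<longleftrightarrow>
     field_embedding \<iota> \<and>
     (\<exists>x. \<not> algebraic_over \<iota> x \<and>
        (\<exists>S. finite S \<and>
           (\<forall>y. \<exists>r. (\<forall>s\<in>S. r s \<in> simple_field_extension \<iota> x) \<and> y = (\<Sum>s\<in>S. r s * s)))) \<and>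
     (\<forall>x. algebraic_over \<iota> x \<longrightarrow> x \<in> range \<iota>)"

text \<open>
  A point is identified with its normalised discrete valuation. Valuations are integer valued;
  the value at \<open>0\<close>, mathematically \<open>\<infinity>\<close>, is a dummy that is fixed to be \<open>0\<close>, so that distinct
  functions are distinct points.
\<close>

type_synonym 'a point = "'a \<Rightarrow> int"

definition points :: "('k::field \<Rightarrow> 'a::field) \<Rightarrow> 'a point set" where
  "points \<iota> = {v.
     v 0 = 0 \<and>
     (\<forall>x y. x \<noteq> 0 \<longrightarrow> y \<noteq> 0 \<longrightarrow> v (x * y) = v x + v y) \<and>
     (\<forall>x y. x \<noteq> 0 \<longrightarrow> y \<noteq> 0 \<longrightarrow> x + y \<noteq> 0 \<longrightarrow> min (v x) (v y) \<le> v (x + y)) \<and>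
     (\<forall>c. v (\<iota> c) = 0) \<and>
     (\<exists>t. t \<noteq> 0 \<and> v t = 1)}"

definition local_ring :: "'a::field point \<Rightarrow> 'a set" where
  "local_ring v = {x. x = 0 \<or> v x \<ge> 0}"

definition max_ideal :: "'a::field point \<Rightarrow> 'a set" where
  "max_ideal v = {x. x = 0 \<or> v x > 0}"

text \<open>
  The degree of a point is the dimension over \<open>k\<close> of its residue field: \<open>b\<close> ranges over lifts
  to the local ring of the bases of the residue field.
\<close>

definition point_degree :: "('k::field \<Rightarrow> 'a::field) \<Rightarrow> 'a point \<Rightarrow> nat" where
  "point_degree \<iota> v = (THE n. \<exists>b. finite b \<and> card b = n \<and> b \<subseteq> local_ring v \<and>
     (\<forall>x\<in>local_ring v.
        \<exists>!c. c \<in> b \<rightarrow>\<^sub>E (UNIV :: 'k set) \<and> x - (\<Sum>s\<in>b. \<iota> (c s) * s) \<in> max_ideal v))"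

definition rational_points :: "('k::field \<Rightarrow> 'a::field) \<Rightarrow> 'a point set" where
  "rational_points \<iota> = {v \<in> points \<iota>. point_degree \<iota> v = 1}"

type_synonym 'a divisor = "'a point \<Rightarrow>\<^sub>0 int"

definition divisors :: "('k::field \<Rightarrow> 'a::field) \<Rightarrow> 'a divisor set" where
  "divisors \<iota> = {D. Poly_Mapping.keys D \<subseteq> points \<iota>}"

definition degree_divisor :: "('k::field \<Rightarrow> 'a::field) \<Rightarrow> 'a divisor \<Rightarrow> int" where
  "degree_divisor \<iota> D =
     (\<Sum>v\<in>Poly_Mapping.keys D. Poly_Mapping.lookup D v * int (point_degree \<iota> v))"

text \<open>The coefficient at \<open>v\<close> of the divisor \<open>(f)\<close> of a nonzero function \<open>f\<close> is \<open>v f\<close>.\<close>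

definition L_space :: "('k::field \<Rightarrow> 'a::field) \<Rightarrow> 'a divisor \<Rightarrow> 'a set" where
  "L_space \<iota> E = {f. f \<noteq> 0 \<and> (\<forall>v\<in>points \<iota>. v f + Poly_Mapping.lookup E v \<ge> 0)} \<union> {0}"

definition lin_equiv :: "('k::field \<Rightarrow> 'a::field) \<Rightarrow> ('a divisor \<times> 'a divisor) set" where
  "lin_equiv \<iota> = {(D, E). D \<in> divisors \<iota> \<and> E \<in> divisors \<iota> \<and>
     (\<exists>f. f \<noteq> 0 \<and> (\<forall>v\<in>points \<iota>. Poly_Mapping.lookup (D - E) v = v f))}"

definition divisor_class :: "('k::field \<Rightarrow> 'a::field) \<Rightarrow> 'a divisor \<Rightarrow> 'a divisor set" where
  "divisor_class \<iota> D = lin_equiv \<iota> `` {D}"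

definition Gamma_P :: "('k::field \<Rightarrow> 'a::field) \<Rightarrow> 'a point \<Rightarrow> 'a divisor set set" where
  "Gamma_P \<iota> P =
     {divisor_class \<iota> A |A. A \<in> divisors \<iota> \<and>
        L_space \<iota> A \<noteq> L_space \<iota> (A - Poly_Mapping.single P 1)}"

definition Gamma_PC ::
    "('k::field \<Rightarrow> 'a::field) \<Rightarrow> 'a point \<Rightarrow> 'a divisor \<Rightarrow> 'a divisor set set" where
  "Gamma_PC \<iota> P C =
     {divisor_class \<iota> A |A. A \<in> divisors \<iota> \<and>
        divisor_class \<iota> A \<in> Gamma_P \<iota> P \<and> divisor_class \<iota> (A - C) \<in> Gamma_P \<iota> P}"

definition gamma_P :: "('k::field \<Rightarrow> 'a::field) \<Rightarrow> 'a point \<Rightarrow> 'a divisor \<Rightarrow> int" where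
  "gamma_P \<iota> P C =
     (LEAST d. d \<in> {degree_divisor \<iota> A |A. A \<in> divisors \<iota> \<and> divisor_class \<iota> A \<in> Gamma_PC \<iota> P C})"

definition Delta_P ::
    "('k::field \<Rightarrow> 'a::field) \<Rightarrow> 'a point \<Rightarrow> 'a divisor \<Rightarrow> 'a divisor \<Rightarrow> 'a divisor set set" where
  "Delta_P \<iota> P B C =
     {divisor_class \<iota> (B + Poly_Mapping.single P i) |i::int.
        divisor_class \<iota> (B + Poly_Mapping.single P i) \<in> Gamma_P \<iota> P \<and>
        divisor_class \<iota> (B - C + Poly_Mapping.single P i) \<notin> Gamma_P \<iota> P}"

end

theory Submission
  imports Defs "HOL-Library.Cardinality"
begin

text \<open>
  For a divisor \<open>D\<close> let \<open>G D\<close> be the set of \<open>i\<close> with \<open>D + iP \<in> \<Gamma>\<^sub>P\<close>. Since \<open>P\<close> is rational,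
  \<open>G D\<close> has \<open>\<ell>(D + nP)\<close> elements up to \<open>n\<close>, so Riemann's theorem \<open>\<ell>(D + nP) = deg D + n + const\<close>
  for large \<open>n\<close> gives \<open>#(G B - G (B - C)) - #(G (B - C) - G B) = deg C\<close>. With \<open>\<gamma>\<^sub>P(-C) = \<gamma>\<^sub>P(C) - deg C\<close>
  this makes the two bounds equivalent; the first one follows because \<open>\<Gamma>\<^sub>P\<close> is closed under
  addition.

  Riemann's theorem is obtained by counting over the finite constant field \<open>k\<close> with \<open>q\<close>
  elements. The degree of the zeros of a transcendental \<open>x\<close> is at most \<open>[F : k(x)]\<close> by weak
  approximation, and \<open>[F : k(x)]\<close> is at most the degree of its poles, because the combinations of
  a \<open>k(x)\<close>-basis with polynomial coefficients of bounded degree lie in \<open>L(m (x)\<^sub>\<infinity> + C)\<close>. The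
  finiteness of these spaces rests on \<open>L(0) = k\<close>, that is, on the existence of poles.
\<close>

text \<open>The constant in Riemann's theorem is \<open>1 - g\<close>, but it is never identified:
  up to sign it is the maximum of \<open>excess D\<close>, that is of \<open>deg D - ell D\<close>,
  and all that is used is that one value serves every divisor, so that it cancels when two divisors
  are compared. The obstacle is that degrees must be known to be class invariants before anything
  can be counted. This is what makes distinct \<open>i\<close> give distinct classes
  \<open>B + iP\<close> and what makes spaces of negative degree vanish, and it amounts to the
  balance of zeros and poles of a function. For the equivalence, the substitution of
  \<open>A - C\<close> for \<open>A\<close> exchanges the two conditions that define
  \<open>\<Gamma>\<^sub>P(C)\<close> and lowers all degrees by \<open>deg C\<close>; the
  cardinalities of the two sets \<open>\<Delta>\<^sub>P\<close> differ by the same amount.\<close>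

locale function_field =
  fixes \<iota> :: "'k::{field,finite} \<Rightarrow> 'a::field"
  assumes curve: "curve \<iota>"
begin

section \<open>Constants of the function field\<close>

abbreviation transcendental :: "'a \<Rightarrow> bool" where
  "transcendental x \<equiv> \<not> algebraic_over \<iota> x"

lemma iota_1 [simp]: "\<iota> 1 = 1"
  and iota_add [simp]: "\<iota> (a + b) = \<iota> a + \<iota> b"
  and iota_mult [simp]: "\<iota> (a * b) = \<iota> a * \<iota> b"
  using curve unfolding curve_def field_embedding_def by blast+

lemma iota_0 [simp]: "\<iota> 0 = 0"
  using iota_add[of 0 0] by (metis add_cancel_right_right add_0)

lemma iota_minus [simp]: "\<iota> (- a) = - \<iota> a"
  using iota_add[of a "- a"] by (metis add.right_inverse iota_0 minus_unique)

lemma iota_diff [simp]: "\<iota> (a - b) = \<iota> a - \<iota> b"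
  using iota_add[of a "- b"] by simp

lemma iota_eq_0_iff [simp]: "\<iota> a = 0 \<longleftrightarrow> a = 0"
  by (metis iota_0 iota_1 iota_mult mult_zero_left right_inverse zero_neq_one)

lemma iota_inverse: "\<iota> (inverse a) = inverse (\<iota> a)"
  by (cases "a = 0") (simp, metis iota_1 iota_mult inverse_unique right_inverse)

lemma q_gt_1: "CARD('k) > 1"
proof -
  have "card {0, 1::'k} \<le> CARD('k)"
    by (rule card_mono) auto
  then show ?thesis
    by simp
qed

lemma q_power_le_iff [simp]: "CARD('k) ^ m \<le> CARD('k) ^ n \<longleftrightarrow> m \<le> n"
  using q_gt_1 by simp

lemma q_power_eq_iff [simp]: "CARD('k) ^ m = CARD('k) ^ n \<longleftrightarrow> m = n"
  using q_gt_1 by simp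


section \<open>Linear independence over the ring of polynomials in a function\<close>

definition ev :: "'k poly \<Rightarrow> 'a \<Rightarrow> 'a" where
  "ev p x = poly (map_poly \<iota> p) x"

lemma ev_0 [simp]: "ev 0 x = 0"
  by (simp add: ev_def)

lemma ev_pCons [simp]: "ev (pCons a p) x = \<iota> a + x * ev p x"
  by (simp add: ev_def map_poly_pCons)

lemma ev_1 [simp]: "ev 1 x = 1"
  by (simp add: one_pCons)

lemma ev_add [simp]: "ev (p + r) x = ev p x + ev r x"
  by (induction p r rule: poly_induct2) (auto simp: algebra_simps)

lemma ev_minus [simp]: "ev (- p) x = - ev p x"
  by (induction p) auto

lemma ev_diff [simp]: "ev (p - r) x = ev p x - ev r x"
  using ev_add[of p "- r"] by simp

lemma ev_smult [simp]: "ev (smult a p) x = \<iota> a * ev p x"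
  by (induction p) (auto simp: algebra_simps)

lemma ev_mult [simp]: "ev (p * r) x = ev p x * ev r x"
  by (induction p) (auto simp: algebra_simps)

lemma ev_sum: "ev (\<Sum>i\<in>A. p i) x = (\<Sum>i\<in>A. ev (p i) x)"
  by (induction A rule: infinite_finite_induct) auto

lemma ev_prod: "ev (\<Prod>i\<in>A. p i) x = (\<Prod>i\<in>A. ev (p i) x)"
  by (induction A rule: infinite_finite_induct) auto

lemma ev_monom [simp]: "ev (monom a n) x = \<iota> a * x ^ n"
  by (induction n) (auto simp: monom_0 monom_Suc algebra_simps)

lemma ev_altdef: "degree p \<le> n \<Longrightarrow> ev p x = (\<Sum>i\<le>n. \<iota> (coeff p i) * x ^ i)"
proof -
  assume "degree p \<le> n"
  then have "p = (\<Sum>i\<le>n. monom (coeff p i) i)"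
    by (rule poly_as_sum_of_monoms'[symmetric])
  then have "ev p x = ev (\<Sum>i\<le>n. monom (coeff p i) i) x"
    by simp
  then show ?thesis
    by (simp add: ev_sum)
qed

lemma algebraic_over_iff: "algebraic_over \<iota> x \<longleftrightarrow> (\<exists>p. p \<noteq> 0 \<and> ev p x = 0)"
  by (simp add: algebraic_over_def ev_def)

lemma transcendental_ev_eq_0 [simp]: "transcendental x \<Longrightarrow> ev p x = 0 \<longleftrightarrow> p = 0"
  by (auto simp: algebraic_over_iff)

lemma algebraic_range: "algebraic_over \<iota> x \<Longrightarrow> x \<in> range \<iota>"
  using curve unfolding curve_def by blast

lemma algebraic_iota: "algebraic_over \<iota> (\<iota> a)"
  unfolding algebraic_over_iff by (rule exI[of _ "[:- a, 1:]"]) simp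

lemma algebraic_iff_range: "algebraic_over \<iota> x \<longleftrightarrow> x \<in> range \<iota>"
  using algebraic_range algebraic_iota by blast

lemma transcendental_inverse: "transcendental x \<Longrightarrow> transcendental (inverse x)"
  by (metis algebraic_iff_range iota_inverse inverse_inverse_eq rangeE rangeI)

lemma transcendental_nonzero: "transcendental x \<Longrightarrow> x \<noteq> 0"
  by (metis algebraic_iota iota_0)

text \<open>Independence of \<open>u 0\<close>, ..., \<open>u (n - 1)\<close> over
  \<open>k[x]\<close>, which for transcendental \<open>x\<close> is independence over
  \<open>k(x)\<close> after clearing denominators. Coefficients are kept polynomial because
  polynomials of bounded degree can be counted.\<close>

definition free :: "'a \<Rightarrow> nat \<Rightarrow> (nat \<Rightarrow> 'a) \<Rightarrow> bool" where
  "free x n u \<longleftrightarrow> (\<forall>p. (\<Sum>i<n. ev (p i) x * u i) = 0 \<longrightarrow> (\<forall>i<n. p i = 0))"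

lemma free_scale:
  assumes "free x n u" "c \<noteq> 0"
  shows "free x n (\<lambda>i. c * u i)"
  unfolding free_def
proof (intro allI impI)
  fix p i
  assume "(\<Sum>i<n. ev (p i) x * (c * u i)) = 0" "i < n"
  moreover have "(\<Sum>i<n. ev (p i) x * (c * u i)) = c * (\<Sum>i<n. ev (p i) x * u i)"
    by (simp add: sum_distrib_left algebra_simps)
  ultimately show "p i = 0"
    using assms by (auto simp: free_def)
qed

lemma free_nonzero: "free x n u \<Longrightarrow> i < n \<Longrightarrow> u i \<noteq> 0"
proof
  assume *: "free x n u" "i < n" "u i = 0"
  define p :: "nat \<Rightarrow> 'k poly" where "p j = (if j = i then 1 else 0)" for j
  have "(\<Sum>j<n. ev (p j) x * u j) = 0"
    using * by (intro sum.neutral) (auto simp: p_def)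
  then have "p i = 0"
    using * unfolding free_def by blast
  then show False
    by (simp add: p_def)
qed

text \<open>Splitting off the constant term multiplies the count by \<open>q\<close>. The zero
  polynomial is included, having degree 0, so the exponent is \<open>m + 1\<close>.\<close>

lemma card_degree_le: "finite {p::'k poly. degree p \<le> m} \<and> card {p::'k poly. degree p \<le> m} = CARD('k) ^ Suc m"
proof (induction m)
  case 0
  have "{p::'k poly. degree p \<le> 0} = (\<lambda>a. [:a:]) ` UNIV"
    by (auto simp: image_iff elim: degree_eq_zeroE)
  moreover have "inj (\<lambda>a::'k. [:a:])"
    by (rule injI) simp
  ultimately show ?case
    by (simp add: card_image)
next
  case (Suc m)
  have "{p::'k poly. degree p \<le> Suc m} = (\<lambda>(a, p). pCons a p) ` (UNIV \<times> {p. degree p \<le> m})"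
  proof (intro set_eqI iffI)
    fix p :: "'k poly" assume "p \<in> {p. degree p \<le> Suc m}"
    moreover obtain a r where "p = pCons a r"
      by (cases p)
    ultimately show "p \<in> (\<lambda>(a, p). pCons a p) ` (UNIV \<times> {p. degree p \<le> m})"
      by (auto simp: degree_pCons_eq_if split: if_splits intro!: image_eqI[of _ _ "(a, r)"])
  qed (auto simp: degree_pCons_eq_if)
  moreover have "inj_on (\<lambda>(a, p). pCons a p) (UNIV \<times> {p::'k poly. degree p \<le> m})"
    by (auto simp: inj_on_def)
  ultimately show ?case
    using Suc by (simp add: card_image card_cartesian_product)
qed

lemma card_poly_families:
  assumes "finite I"
  shows "finite (I \<rightarrow>\<^sub>E {p::'k poly. degree p \<le> m})"
    and "card (I \<rightarrow>\<^sub>E {p::'k poly. degree p \<le> m}) = CARD('k) ^ (Suc m * card I)"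
  using assms card_degree_le[of m]
  by (auto simp: card_PiE power_mult simp del: power_Suc mult_Suc intro!: finite_PiE)

lemma free_inj_on:
  assumes "free x n u"
  shows "inj_on (\<lambda>p. \<Sum>i<n. ev (p i) x * u i) ({..<n} \<rightarrow>\<^sub>E A)"
proof (rule inj_onI)
  fix p r assume pr: "p \<in> {..<n} \<rightarrow>\<^sub>E A" "r \<in> {..<n} \<rightarrow>\<^sub>E A"
    and "(\<Sum>i<n. ev (p i) x * u i) = (\<Sum>i<n. ev (r i) x * u i)"
  then have "(\<Sum>i<n. ev (p i - r i) x * u i) = 0"
    by (simp add: algebra_simps sum_subtractf)
  then have "\<forall>i<n. p i - r i = 0"
    using assms unfolding free_def by (elim allE[of _ "\<lambda>i. p i - r i"]) simp
  then show "p = r"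
    using pr by (intro PiE_ext[of p "{..<n}" "\<lambda>_. A"]) auto
qed

definition poly_span :: "'a \<Rightarrow> 'a set \<Rightarrow> 'a set" where
  "poly_span x T = {\<Sum>t\<in>T. ev (p t) x * t |p. True}"

lemma poly_span_0: "0 \<in> poly_span x T"
  unfolding poly_span_def by (auto intro!: exI[of _ "\<lambda>_. 0"])

lemma poly_span_add: "a \<in> poly_span x T \<Longrightarrow> b \<in> poly_span x T \<Longrightarrow> a + b \<in> poly_span x T"
proof -
  assume "a \<in> poly_span x T" "b \<in> poly_span x T"
  then obtain p r where "a = (\<Sum>t\<in>T. ev (p t) x * t)" "b = (\<Sum>t\<in>T. ev (r t) x * t)"
    unfolding poly_span_def by blast
  then show ?thesis
    unfolding poly_span_def
    by (auto intro!: exI[of _ "\<lambda>t. p t + r t"] simp: algebra_simps sum.distrib)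
qed

lemma poly_span_ev: "a \<in> poly_span x T \<Longrightarrow> ev c x * a \<in> poly_span x T"
proof -
  assume "a \<in> poly_span x T"
  then obtain p where "a = (\<Sum>t\<in>T. ev (p t) x * t)"
    unfolding poly_span_def by blast
  then show ?thesis
    unfolding poly_span_def
    by (auto intro!: exI[of _ "\<lambda>t. c * p t"] simp: algebra_simps sum_distrib_left)
qed

lemma poly_span_base: "finite T \<Longrightarrow> t \<in> T \<Longrightarrow> t \<in> poly_span x T"
proof -
  assume *: "finite T" "t \<in> T"
  have "(\<Sum>s\<in>T. ev (if s = t then 1 else 0) x * s) = (\<Sum>s\<in>T. if s = t then s else 0)"
    by (rule sum.cong) auto
  then have "t = (\<Sum>s\<in>T. ev (if s = t then 1 else 0) x * s)"
    using * by simp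
  then show ?thesis
    unfolding poly_span_def by (intro CollectI exI[of _ "\<lambda>s. if s = t then 1 else 0"]) simp
qed

text \<open>
  Pigeonhole: combinations of \<open>n\<close> free elements with coefficients of degree at most \<open>m\<close> are
  \<open>q ^ (n (m + 1))\<close> in number, and \<open>m\<close> is arbitrary.
\<close>

lemma free_poly_span_le:
  assumes "finite T" "free x n u" "\<And>i. i < n \<Longrightarrow> u i \<in> poly_span x T"
  shows "n \<le> card T"
proof -
  let ?k = "card T"
  obtain a where a: "\<And>i. i < n \<Longrightarrow> u i = (\<Sum>t\<in>T. ev (a i t) x * t)"
    using assms(3) unfolding poly_span_def by (simp, metis)
  \<comment> \<open>A bound for the degrees of all coordinates of the \<open>u i\<close>: expressing
    combinations of the \<open>u i\<close> through \<open>T\<close> raises coefficient degrees by at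
    most \<open>d\<close>. The inserted 0 covers an empty index set.\<close>
  define d where "d = Max (insert 0 ((\<lambda>(i, t). degree (a i t)) ` ({..<n} \<times> T)))"
  have d: "degree (a i t) \<le> d" if "i < n" "t \<in> T" for i t
    unfolding d_def using that assms(1) by (intro Max_ge) auto
  have bound: "Suc m * n \<le> Suc (m + d) * ?k" for m
  proof -
    let ?A = "{..<n} \<rightarrow>\<^sub>E {p::'k poly. degree p \<le> m}"
    let ?B = "T \<rightarrow>\<^sub>E {p::'k poly. degree p \<le> m + d}"
    let ?f = "\<lambda>p. \<Sum>i<n. ev (p i) x * u i"
    let ?g = "\<lambda>p. \<Sum>t\<in>T. ev (p t) x * t"
    have "?f ` ?A \<subseteq> ?g ` ?B"
    proof
      fix y assume "y \<in> ?f ` ?A"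
      then obtain p where p: "p \<in> ?A" "y = ?f p"
        by blast
      define r where "r = (\<lambda>t\<in>T. \<Sum>i<n. p i * a i t)"
      have "degree (\<Sum>i<n. p i * a i t) \<le> m + d" if "t \<in> T" for t
      proof (rule degree_sum_le)
        fix i assume "i \<in> {..<n}"
        then have "degree (p i) \<le> m" "degree (a i t) \<le> d"
          using p d that by auto
        then show "degree (p i * a i t) \<le> m + d"
          using degree_mult_le[of "p i" "a i t"] by linarith
      qed simp
      then have "r \<in> ?B"
        by (auto simp: r_def)
      moreover have "y = ?g r"
      proof -
        have "y = (\<Sum>i<n. \<Sum>t\<in>T. ev (p i) x * (ev (a i t) x * t))"
          using p a by (auto simp: sum_distrib_left intro!: sum.cong)
        also have "\<dots> = (\<Sum>t\<in>T. \<Sum>i<n. ev (p i) x * (ev (a i t) x * t))"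
          by (rule sum.swap)
        also have "\<dots> = ?g r"
          by (intro sum.cong) (auto simp: r_def ev_sum sum_distrib_right sum_distrib_left algebra_simps)
        finally show ?thesis .
      qed
      ultimately show "y \<in> ?g ` ?B"
        by blast
    qed
    then have "card (?f ` ?A) \<le> card (?g ` ?B)"
      using assms(1) by (intro card_mono finite_imageI card_poly_families)
    also have "\<dots> \<le> card ?B"
      using assms(1) by (intro card_image_le card_poly_families)
    finally have "card ?A \<le> card ?B"
      using free_inj_on[OF assms(2)] by (simp add: card_image)
    then have "CARD('k) ^ (Suc m * n) \<le> CARD('k) ^ (Suc (m + d) * ?k)"
      using assms(1) card_poly_families(2)[of "{..<n}" m] card_poly_families(2)[of T "m + d"]
      by simp
    then show ?thesis
      by (simp only: q_power_le_iff)
  qed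
  show ?thesis
  proof (rule ccontr)
    assume "\<not> ?thesis"
    \<comment> \<open>The bound is used at \<open>m = d * card T\<close>: for
      \<open>n = card T + 1\<close> its left side exceeds its right side by exactly 1.\<close>
    then have "Suc (d * ?k) * Suc ?k \<le> Suc (d * ?k) * n"
      by (intro mult_le_mono2) simp
    also have "\<dots> \<le> Suc (d * ?k + d) * ?k"
      by (rule bound)
    finally show False
      by (simp add: algebra_simps)
  qed
qed

text \<open>The \<open>k(x)\<close>-span of \<open>T\<close>; a single common denominator
  \<open>ev c x\<close> stands in for the rational coefficients.\<close>

definition rat_span :: "'a \<Rightarrow> 'a set \<Rightarrow> 'a set" where
  "rat_span x T = {z. \<exists>c. ev c x \<noteq> 0 \<and> ev c x * z \<in> poly_span x T}"

lemma rat_span_0: "0 \<in> rat_span x T"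
  unfolding rat_span_def by (auto intro!: exI[of _ 1] poly_span_0)

lemma poly_span_subset_rat_span: "poly_span x T \<subseteq> rat_span x T"
  unfolding rat_span_def by (auto intro!: exI[of _ 1])

lemma rat_span_add:
  assumes "a \<in> rat_span x T" "b \<in> rat_span x T"
  shows "a + b \<in> rat_span x T"
proof -
  obtain c d where "ev c x \<noteq> 0" "ev c x * a \<in> poly_span x T"
      "ev d x \<noteq> 0" "ev d x * b \<in> poly_span x T"
    using assms unfolding rat_span_def by blast
  then have "ev (c * d) x \<noteq> 0" "ev d x * (ev c x * a) + ev c x * (ev d x * b) \<in> poly_span x T"
    by (auto intro: poly_span_add poly_span_ev)
  then show ?thesis
    unfolding rat_span_def by (auto intro!: exI[of _ "c * d"] simp: algebra_simps)
qed

lemma rat_span_ev: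
  assumes "a \<in> rat_span x T"
  shows "ev p x * a \<in> rat_span x T"
proof -
  obtain c where "ev c x \<noteq> 0" "ev c x * a \<in> poly_span x T"
    using assms unfolding rat_span_def by blast
  then show ?thesis
    unfolding rat_span_def using poly_span_ev[of "ev c x * a" x T p]
    by (auto intro!: exI[of _ c] simp: algebra_simps)
qed

lemma rat_span_ev_cancel:
  assumes "ev p x * a \<in> rat_span x T" "ev p x \<noteq> 0"
  shows "a \<in> rat_span x T"
proof -
  obtain c where "ev c x \<noteq> 0" "ev c x * (ev p x * a) \<in> poly_span x T"
    using assms unfolding rat_span_def by blast
  then show ?thesis
    unfolding rat_span_def using assms(2)
    by (auto intro!: exI[of _ "c * p"] simp: algebra_simps)
qed

lemma rat_span_sum: "(\<And>i. i \<in> A \<Longrightarrow> f i \<in> rat_span x T) \<Longrightarrow> (\<Sum>i\<in>A. f i) \<in> rat_span x T"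
  by (induction A rule: infinite_finite_induct) (auto intro: rat_span_0 rat_span_add)

text \<open>The product of all denominators moves the family into \<open>poly_span x T\<close>, and
  \<open>free_scale\<close> keeps it free.\<close>

lemma free_rat_span_le:
  assumes "finite T" "free x n u" "\<And>i. i < n \<Longrightarrow> u i \<in> rat_span x T"
  shows "n \<le> card T"
proof -
  obtain c where c: "\<And>i. i < n \<Longrightarrow> ev (c i) x \<noteq> 0 \<and> ev (c i) x * u i \<in> poly_span x T"
    using assms(3) unfolding rat_span_def by (simp, metis)
  define e where "e = ev (\<Prod>i<n. c i) x"
  have "e \<noteq> 0"
    using c by (auto simp: e_def ev_prod)
  moreover have "e * u i \<in> poly_span x T" if "i < n" for i
  proof -
    have "e = ev (\<Prod>j\<in>{..<n} - {i}. c j) x * ev (c i) x"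
      unfolding e_def ev_mult[symmetric] using that by (subst prod.remove[of _ i]) (auto simp: mult.commute)
    then show ?thesis
      using poly_span_ev[of "ev (c i) x * u i" x T] c that by (simp add: mult.assoc)
  qed
  ultimately show ?thesis
    using free_poly_span_le[OF assms(1) free_scale[OF assms(2), of e]] by blast
qed

lemma ex_generators:
  obtains x S where "transcendental x" "finite S" "rat_span x S = UNIV"
proof -
  from curve obtain x S where x: "transcendental x" "finite S" and
    gen: "\<And>y. \<exists>r. (\<forall>s\<in>S. r s \<in> simple_field_extension \<iota> x) \<and> y = (\<Sum>s\<in>S. r s * s)"
    unfolding curve_def by blast
  have "y \<in> rat_span x S" for y
  proof -
    obtain r where r: "\<forall>s\<in>S. r s \<in> simple_field_extension \<iota> x" "y = (\<Sum>s\<in>S. r s * s)"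
      using gen by blast
    have "r s * s \<in> rat_span x S" if s: "s \<in> S" for s
    proof -
      obtain p d where pd: "r s = ev p x / ev d x" "ev d x \<noteq> 0"
        using r s unfolding simple_field_extension_def ev_def by blast
      have "ev p x * s \<in> rat_span x S"
        using poly_span_base[OF x(2) s] poly_span_subset_rat_span by (intro rat_span_ev) auto
      then have "ev d x * (r s * s) \<in> rat_span x S"
        using pd by simp
      then show ?thesis
        using pd(2) by (rule rat_span_ev_cancel)
    qed
    then show ?thesis
      unfolding r(2) by (rule rat_span_sum)
  qed
  then show thesis
    using that x by blast
qed

text \<open>
  If the field is finite over \<open>k(z)\<close>, then a relation between \<open>x\<close> and \<open>z\<close> makes it finite
  over \<open>k(x)\<close> as well. Denominators in \<open>z\<close> need not be inverted: a common nonzero factor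
  does not affect freeness.
\<close>

lemma free_bounded:
  assumes x: "transcendental x"
  shows "\<exists>K. \<forall>n u. free x n u \<longrightarrow> n \<le> K"
proof -
  obtain z S where z: "transcendental z" and S: "finite S" "rat_span z S = UNIV"
    by (rule ex_generators)
  let ?N = "Suc (card S)"
  \<comment> \<open>The powers \<open>1\<close>, \<open>x\<close>, ..., \<open>x ^ card S\<close>
    outnumber the generators over \<open>k(z)\<close>, so they satisfy a nontrivial relation with
    polynomial coefficients in \<open>z\<close>.\<close>
  have "\<not> free z ?N (\<lambda>i. x ^ i)"
    using free_rat_span_le[OF S(1), of z ?N "\<lambda>i. x ^ i"] S(2) by auto
  then obtain p i0 where p: "(\<Sum>i<?N. ev (p i) z * x ^ i) = 0" and i0: "i0 < ?N" "p i0 \<noteq> 0"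
    unfolding free_def by blast
  define D where "D = Max ((\<lambda>i. degree (p i)) ` {..<?N})"
  have D: "degree (p i) \<le> D" if "i < ?N" for i
    unfolding D_def using that by (intro Max_ge) auto
  \<comment> \<open>The same relation sorted by powers of \<open>z\<close>: \<open>c j\<close>
    collects the coefficient of \<open>z ^ j\<close> as a polynomial in \<open>x\<close>.\<close>
  define c where "c j = (\<Sum>i<?N. monom (coeff (p i) j) i)" for j
  have coeff_c: "coeff (c j) i = coeff (p i) j" if "i < ?N" for i j
  proof -
    have "coeff (c j) i = (\<Sum>i'<?N. if i' = i then coeff (p i') j else 0)"
      by (simp add: c_def coeff_sum)
    then show ?thesis
      using that by simp
  qed
  have rel: "(\<Sum>j\<le>D. ev (c j) x * z ^ j) = 0"
  proof -
    have "(\<Sum>j\<le>D. ev (c j) x * z ^ j) = (\<Sum>j\<le>D. \<Sum>i<?N. \<iota> (coeff (p i) j) * x ^ i * z ^ j)"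
      by (simp only: c_def ev_sum ev_monom sum_distrib_right)
    also have "\<dots> = (\<Sum>i<?N. \<Sum>j\<le>D. \<iota> (coeff (p i) j) * x ^ i * z ^ j)"
      by (rule sum.swap)
    also have "\<dots> = (\<Sum>i<?N. ev (p i) z * x ^ i)"
      using D by (intro sum.cong) (auto simp: ev_altdef[of _ D] sum_distrib_right sum_distrib_left algebra_simps)
    finally show ?thesis
      using p by simp
  qed
  have "c (degree (p i0)) \<noteq> 0"
    using coeff_c[of i0 "degree (p i0)"] i0 by force
  then have J: "degree (p i0) \<in> {j. j \<le> D \<and> c j \<noteq> 0}"
    using D i0 by auto
  \<comment> \<open>The degree of the relation in \<open>z\<close>. It is positive, since
    \<open>d = 0\<close> would leave a nonzero polynomial vanishing at the transcendental
    \<open>x\<close>.\<close>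
  define d where "d = Max {j. j \<le> D \<and> c j \<noteq> 0}"
  have d: "d \<le> D" "c d \<noteq> 0"
    using Max_in[of "{j. j \<le> D \<and> c j \<noteq> 0}"] J unfolding d_def[symmetric] by auto
  have above: "c j = 0" if "d < j" "j \<le> D" for j
    using Max_ge[of "{j. j \<le> D \<and> c j \<noteq> 0}" j] that unfolding d_def by fastforce
  have "(\<Sum>j\<le>D. ev (c j) x * z ^ j) = (\<Sum>j\<le>d. ev (c j) x * z ^ j)"
    using d above by (intro sum.mono_neutral_right) auto
  also have "\<dots> = ev (c d) x * z ^ d + (\<Sum>j<d. ev (c j) x * z ^ j)"
    by (simp add: lessThan_Suc_atMost[symmetric])
  finally have red: "ev (c d) x * z ^ d = (\<Sum>j<d. ev (- c j) x * z ^ j)"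
    using rel by (simp add: sum_negf eq_neg_iff_add_eq_0)
  have cd: "ev (c d) x \<noteq> 0"
    using d x by simp
  then have d_pos: "d > 0"
    using red by (cases d) auto
  \<comment> \<open>As \<open>z\<close> has degree at most \<open>d\<close> over
    \<open>k(x)\<close>, the products \<open>z ^ i * s\<close> with \<open>i < d\<close> generate a
    \<open>k(x)\<close>-space that contains \<open>S\<close> and is stable under \<open>z\<close>,
    hence contains \<open>poly_span z S\<close>.\<close>
  define T where "T = (\<lambda>(i, s). z ^ i * s) ` ({..<d} \<times> S)"
  have T: "finite T"
    unfolding T_def using S by simp
  have T_base: "z ^ i * s \<in> rat_span x T" if "i < d" "s \<in> S" for i s
    using that poly_span_base[OF T, of "z ^ i * s" x] poly_span_subset_rat_span
    by (force simp: T_def)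
  have T_z: "z * t \<in> rat_span x T" if t: "t \<in> T" for t
  proof -
    obtain i s where ts: "i < d" "s \<in> S" "t = z ^ i * s"
      using t by (auto simp: T_def)
    show ?thesis
    proof (cases "Suc i < d")
      case True
      then show ?thesis
        using T_base[of "Suc i" s] ts by (simp add: algebra_simps)
    next
      case False
      then have "d = Suc i"
        using ts by simp
      then have "ev (c d) x * (z * t) = (ev (c d) x * z ^ d) * s"
        using ts by (simp add: algebra_simps)
      also have "\<dots> = (\<Sum>j<d. ev (- c j) x * (z ^ j * s))"
        unfolding red sum_distrib_right by (simp add: mult.assoc)
      finally have "ev (c d) x * (z * t) = (\<Sum>j<d. ev (- c j) x * (z ^ j * s))" .
      moreover have "\<dots> \<in> rat_span x T"
        using ts T_base by (intro rat_span_sum rat_span_ev) auto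
      ultimately show ?thesis
        using cd rat_span_ev_cancel by metis
    qed
  qed
  have z_closed: "z * y \<in> rat_span x T" if y: "y \<in> rat_span x T" for y
  proof -
    obtain e where e: "ev e x \<noteq> 0" "ev e x * y \<in> poly_span x T"
      using y unfolding rat_span_def by blast
    then obtain r where r: "ev e x * y = (\<Sum>t\<in>T. ev (r t) x * t)"
      unfolding poly_span_def by blast
    have "ev e x * (z * y) = (\<Sum>t\<in>T. ev (r t) x * (z * t))"
      using r by (metis (no_types, lifting) mult.left_commute sum.cong sum_distrib_left)
    also have "\<dots> \<in> rat_span x T"
      using T_z by (intro rat_span_sum rat_span_ev) auto
    finally show ?thesis
      using e rat_span_ev_cancel by blast
  qed
  have ev_closed: "ev b z * y \<in> rat_span x T" if "y \<in> rat_span x T" for b y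
  proof (induction b)
    case 0
    then show ?case
      by (simp add: rat_span_0)
  next
    case (pCons a b)
    have "ev [:a:] x * y + z * (ev b z * y) \<in> rat_span x T"
      using that pCons z_closed by (intro rat_span_add rat_span_ev) auto
    then show ?case
      by (simp add: algebra_simps)
  qed
  have poly_span_z: "poly_span z S \<subseteq> rat_span x T"
  proof
    fix y assume "y \<in> poly_span z S"
    then obtain r where r: "y = (\<Sum>s\<in>S. ev (r s) z * s)"
      unfolding poly_span_def by blast
    show "y \<in> rat_span x T"
      unfolding r using T_base[OF d_pos] by (intro rat_span_sum ev_closed) auto
  qed
  have "n \<le> card T" if fr: "free x n u" for n u
  proof -
    have "\<exists>b. ev b z \<noteq> 0 \<and> ev b z * u i \<in> poly_span z S" for i
      using S(2) unfolding rat_span_def by blast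
    then obtain b where b: "\<And>i. ev (b i) z \<noteq> 0 \<and> ev (b i) z * u i \<in> poly_span z S"
      by metis
    define e where "e = ev (\<Prod>i<n. b i) z"
    have "e \<noteq> 0"
      using b by (auto simp: e_def ev_prod)
    moreover have "e * u i \<in> rat_span x T" if "i < n" for i
    proof -
      have "e = ev (\<Prod>j\<in>{..<n} - {i}. b j) z * ev (b i) z"
        unfolding e_def ev_mult[symmetric] using that
        by (subst prod.remove[of _ i]) (auto simp: mult.commute)
      then show ?thesis
        using ev_closed[of "ev (b i) z * u i"] b poly_span_z by (auto simp: mult.assoc)
    qed
    ultimately show ?thesis
      using free_rat_span_le[OF T free_scale[OF fr, of e]] by blast
  qed
  then show ?thesis
    by blast
qed

text \<open>For transcendental \<open>x\<close> this is \<open>[F : k(x)]\<close>. Zeros of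
  \<open>x\<close> produce free families and so bound it from below; a free family of this size is
  what bounds it by the poles.\<close>

definition rank :: "'a \<Rightarrow> nat" where
  "rank x = (GREATEST n. \<exists>u. free x n u)"

lemma free_le_rank: "transcendental x \<Longrightarrow> free x n u \<Longrightarrow> n \<le> rank x"
  unfolding rank_def using free_bounded[of x] by (blast intro: Greatest_le_nat)

lemma ex_free_rank:
  assumes "transcendental x"
  shows "\<exists>u. free x (rank x) u"
  unfolding rank_def
proof -
  have "\<exists>u. free x 0 u"
    by (simp add: free_def)
  then show "\<exists>u. free x (GREATEST n. \<exists>u. free x n u) u"
    using free_bounded[OF assms] GreatestI_nat[of "\<lambda>n. \<exists>u. free x n u" 0] by blast
qed


section \<open>Independence over the constants modulo a subspace\<close>

definition subspace :: "'a set \<Rightarrow> bool" where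
  "subspace W \<longleftrightarrow> 0 \<in> W \<and> (\<forall>a\<in>W. \<forall>b\<in>W. a + b \<in> W) \<and> (\<forall>c. \<forall>a\<in>W. \<iota> c * a \<in> W)"

lemma subspace_0: "subspace W \<Longrightarrow> 0 \<in> W"
  and subspace_add: "subspace W \<Longrightarrow> a \<in> W \<Longrightarrow> b \<in> W \<Longrightarrow> a + b \<in> W"
  and subspace_scale: "subspace W \<Longrightarrow> a \<in> W \<Longrightarrow> \<iota> c * a \<in> W"
  by (auto simp: subspace_def)

lemma subspace_minus: "subspace W \<Longrightarrow> a \<in> W \<Longrightarrow> - a \<in> W"
  using subspace_scale[of W a "- 1"] by simp

lemma subspace_diff: "subspace W \<Longrightarrow> a \<in> W \<Longrightarrow> b \<in> W \<Longrightarrow> a - b \<in> W"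
  using subspace_add[of W a "- b"] subspace_minus by simp

lemma subspace_sum: "subspace W \<Longrightarrow> (\<And>i. i \<in> A \<Longrightarrow> f i \<in> W) \<Longrightarrow> (\<Sum>i\<in>A. f i) \<in> W"
  by (induction A rule: infinite_finite_induct) (auto intro: subspace_0 subspace_add)

definition comb :: "nat \<Rightarrow> (nat \<Rightarrow> 'a) \<Rightarrow> (nat \<Rightarrow> 'k) \<Rightarrow> 'a" where
  "comb n u c = (\<Sum>i<n. \<iota> (c i) * u i)"

lemma comb_diff: "comb n u (\<lambda>i. c i - d i) = comb n u c - comb n u d"
  by (simp add: comb_def algebra_simps sum_subtractf)

lemma comb_cong: "(\<And>i. i < n \<Longrightarrow> c i = d i) \<Longrightarrow> comb n u c = comb n u d"
  by (simp add: comb_def)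

lemma comb_restrict: "comb n u (restrict c {..<n}) = comb n u c"
  by (rule comb_cong) simp

lemma comb_scale: "comb n (\<lambda>i. a * u i) c = a * comb n u c"
  by (simp add: comb_def sum_distrib_left algebra_simps)

lemma comb_in_subspace: "subspace W \<Longrightarrow> (\<And>i. i < n \<Longrightarrow> u i \<in> W) \<Longrightarrow> comb n u c \<in> W"
  unfolding comb_def by (intro subspace_sum subspace_scale) auto

text \<open>Independence of residue classes modulo \<open>W\<close>, expressed through lifts.
  Correspondingly \<open>basis n u W W'\<close> says that the \<open>u i\<close> are lifts of a
  basis of \<open>W / W'\<close>.\<close>

definition indep :: "nat \<Rightarrow> (nat \<Rightarrow> 'a) \<Rightarrow> 'a set \<Rightarrow> bool" where
  "indep n u W \<longleftrightarrow> (\<forall>c. comb n u c \<in> W \<longrightarrow> (\<forall>i<n. c i = 0))"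

definition basis :: "nat \<Rightarrow> (nat \<Rightarrow> 'a) \<Rightarrow> 'a set \<Rightarrow> 'a set \<Rightarrow> bool" where
  "basis n u W W' \<longleftrightarrow> (\<forall>i<n. u i \<in> W) \<and> indep n u W' \<and> (\<forall>x\<in>W. \<exists>c. x - comb n u c \<in> W')"

lemma indep_inj:
  assumes "subspace W" "indep n u W" "comb n u c - comb n u d \<in> W" "i < n"
  shows "c i = d i"
proof -
  have "\<forall>i<n. (\<lambda>i. c i - d i) i = 0"
    using assms(2,3) unfolding indep_def comb_diff[symmetric] by blast
  then show ?thesis
    using assms(4) by simp
qed

lemma indep_snoc:
  assumes "subspace W" "indep n u W" "\<And>c. x - comb n u c \<notin> W"
  shows "indep (Suc n) (u(n := x)) W"
  unfolding indep_def
proof (intro allI impI)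
  fix c i
  assume *: "comb (Suc n) (u(n := x)) c \<in> W" "i < Suc n"
  have eq: "comb (Suc n) (u(n := x)) c = comb n u c + \<iota> (c n) * x"
    by (simp add: comb_def)
  have "c n = 0"
  proof (rule ccontr)
    assume c: "c n \<noteq> 0"
    let ?a = "\<iota> (inverse (c n))"
    have "?a * (comb n u c + \<iota> (c n) * x) \<in> W"
      using * eq assms(1) by (intro subspace_scale) auto
    moreover have "?a * (comb n u c + \<iota> (c n) * x) = ?a * comb n u c + (?a * \<iota> (c n)) * x"
      by (simp only: distrib_left mult.assoc)
    moreover have "comb n u (\<lambda>i. - inverse (c n) * c i) = - \<iota> (inverse (c n)) * comb n u c"
      by (simp add: comb_def sum_distrib_left mult.assoc sum_negf)
    moreover have "\<iota> (inverse (c n)) * \<iota> (c n) = 1"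
      using c by (simp flip: iota_mult)
    ultimately have "x - comb n u (\<lambda>i. - inverse (c n) * c i) \<in> W"
      by (simp add: add.commute)
    then show False
      using assms(3) by blast
  qed
  then show "c i = 0"
    using * eq assms(2) by (auto simp: indep_def less_Suc_eq)
qed

text \<open>A longest independent family spans, since otherwise \<open>indep_snoc\<close> extends
  it. Keeping \<open>n \<le> K\<close> in the conclusion turns an a priori bound into a bound for
  the dimension.\<close>

lemma basis_exists:
  assumes W': "subspace W'" and K: "\<And>n u. (\<And>i. i < n \<Longrightarrow> u i \<in> W) \<Longrightarrow> indep n u W' \<Longrightarrow> n \<le> K"
  shows "\<exists>n u. n \<le> K \<and> basis n u W W'"
proof -
  let ?P = "\<lambda>n. \<exists>u. (\<forall>i<n. u i \<in> W) \<and> indep n u W'"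
  define n where "n = (GREATEST n. ?P n)"
  have P0: "?P 0"
    by (simp add: indep_def)
  have bd: "m \<le> K" if "?P m" for m
    using that K by blast
  have "?P n"
    unfolding n_def by (rule GreatestI_nat[of ?P 0 K]) (use P0 bd in auto)
  then obtain u where u: "\<forall>i<n. u i \<in> W" "indep n u W'"
    by blast
  have "\<exists>c. x - comb n u c \<in> W'" if x: "x \<in> W" for x
  proof (rule ccontr)
    assume "\<nexists>c. x - comb n u c \<in> W'"
    then have "indep (Suc n) (u(n := x)) W'"
      using W' u by (intro indep_snoc) auto
    then have "?P (Suc n)"
      using x u by (intro exI[of _ "u(n := x)"]) (auto simp: less_Suc_eq)
    then have "Suc n \<le> n"
      unfolding n_def by (rule Greatest_le_nat[of ?P _ K]) (use bd in auto)
    then show False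
      by simp
  qed
  then show ?thesis
    using u K unfolding basis_def by blast
qed

text \<open>Coordinates with respect to \<open>u\<close> embed the \<open>q ^ m\<close> combinations
  of the \<open>z i\<close> into \<open>q ^ n\<close> vectors; over a finite \<open>k\<close> this
  counting does the work of the exchange lemma.\<close>

lemma indep_le_basis:
  assumes W': "subspace W'" and B: "basis n u W W'" and z: "\<And>i. i < m \<Longrightarrow> z i \<in> W" "indep m z W'"
    and W: "subspace W"
  shows "m \<le> n"
proof -
  define f where "f x = (SOME c. x - comb n u c \<in> W')" for x
  have f: "x - comb n u (f x) \<in> W'" if "x \<in> W" for x
    unfolding f_def using B that by (metis (mono_tags, lifting) basis_def someI_ex)
  let ?g = "\<lambda>c. restrict (f (comb m z c)) {..<n}"
  let ?A = "{..<m} \<rightarrow>\<^sub>E (UNIV :: 'k set)"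
  have "inj_on ?g ?A"
  proof (rule inj_onI)
    fix c d assume cd: "c \<in> ?A" "d \<in> ?A" "?g c = ?g d"
    let ?x = "comb m z c" and ?y = "comb m z d"
    have "?x \<in> W" "?y \<in> W"
      using z W by (auto intro: comb_in_subspace)
    then have "(?x - comb n u (f ?x)) - (?y - comb n u (f ?y)) \<in> W'"
      using f by (blast intro: subspace_diff[OF W'])
    moreover have "comb n u (f ?x) = comb n u (f ?y)"
      using cd(3) by (metis comb_restrict)
    ultimately have "?x - ?y \<in> W'"
      by simp
    then show "c = d"
      using cd(1,2) indep_inj[OF W' z(2)] by (intro PiE_ext[of c "{..<m}" "\<lambda>_. UNIV"]) auto
  qed
  moreover have "?g ` ?A \<subseteq> {..<n} \<rightarrow>\<^sub>E UNIV"
    by (intro image_subsetI) (simp only: restrict_PiE_iff, blast)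
  ultimately have "card ?A \<le> card ({..<n} \<rightarrow>\<^sub>E (UNIV :: 'k set))"
    by (rule card_inj_on_le) (simp add: finite_PiE)
  then show ?thesis
    by (simp add: card_PiE)
qed

lemma basis_card:
  assumes W: "subspace W" and W': "subspace W'" "W' \<subseteq> W" "finite W'" and B: "basis n u W W'"
  shows "finite W" "card W = CARD('k) ^ n * card W'"
proof -
  let ?A = "({..<n} \<rightarrow>\<^sub>E (UNIV :: 'k set)) \<times> W'"
  let ?f = "\<lambda>(c, w). comb n u c + w"
  have "bij_betw ?f ?A W"
    unfolding bij_betw_def
  proof
    show "inj_on ?f ?A"
    proof (rule inj_onI, clarify)
      fix c w d y assume *: "c \<in> {..<n} \<rightarrow>\<^sub>E (UNIV :: 'k set)" "w \<in> W'"
        "d \<in> {..<n} \<rightarrow>\<^sub>E (UNIV :: 'k set)" "y \<in> W'" "comb n u c + w = comb n u d + y"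
      then have "comb n u c - comb n u d = y - w"
        by (simp add: algebra_simps)
      then have "comb n u c - comb n u d \<in> W'"
        using * W' by (simp add: subspace_diff)
      then have "c = d"
        using *(1,3) B indep_inj[OF W'(1)] unfolding basis_def
        by (intro PiE_ext[of c "{..<n}" "\<lambda>_. UNIV"]) auto
      then show "c = d \<and> w = y"
        using * by simp
    qed
    show "?f ` ?A = W"
    proof (intro equalityI subsetI)
      fix x assume "x \<in> ?f ` ?A"
      then obtain c w where "x = comb n u c + w" "w \<in> W'"
        by (elim imageE) (auto simp: split_beta)
      then show "x \<in> W"
        using W W' B unfolding basis_def by (auto intro!: subspace_add comb_in_subspace)
    next
      fix x assume "x \<in> W"
      then obtain c where c: "x - comb n u c \<in> W'"
        using B unfolding basis_def by blast
      show "x \<in> ?f ` ?A"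
        using c by (intro image_eqI[of _ _ "(restrict c {..<n}, x - comb n u c)"])
          (auto simp: comb_restrict)
    qed
  qed
  moreover have "finite ?A" "card ?A = CARD('k) ^ n * card W'"
    using W'(3) by (auto simp: card_cartesian_product card_PiE intro!: finite_PiE finite_cartesian_product)
  ultimately show "finite W" "card W = CARD('k) ^ n * card W'"
    using bij_betw_finite bij_betw_same_card by metis+
qed

text \<open>Modulo \<open>W1\<close> only the \<open>z\<close> part of a relation survives, so its
  coefficients vanish; what remains is a relation of the \<open>u i\<close> modulo
  \<open>W0\<close>. In this way dimensions of successive quotients add up.\<close>

lemma indep_append:
  assumes W0: "W0 \<subseteq> W1" "subspace W1"
    and u: "\<And>i. i < n \<Longrightarrow> u i \<in> W1" "indep n u W0" and z: "indep m z W1"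
  shows "indep (n + m) (\<lambda>i. if i < n then u i else z (i - n)) W0"
  unfolding indep_def
proof (intro allI impI)
  let ?y = "\<lambda>i. if i < n then u i else z (i - n)"
  fix c i assume *: "comb (n + m) ?y c \<in> W0" "i < n + m"
  have "comb (n + m) ?y c
      = (\<Sum>i<n. \<iota> (c i) * ?y i) + (\<Sum>i\<in>{n..<n + m}. \<iota> (c i) * ?y i)"
    using sum.atLeastLessThan_concat[of 0 n "n + m" "\<lambda>i. \<iota> (c i) * ?y i"]
    unfolding comb_def lessThan_atLeast0 by (metis le_add1 zero_le)
  also have "(\<Sum>i\<in>{n..<n + m}. \<iota> (c i) * ?y i) = (\<Sum>i<m. \<iota> (c (i + n)) * ?y (i + n))"
    using sum.shift_bounds_nat_ivl[of "\<lambda>i. \<iota> (c i) * ?y i" 0 n m]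
    by (simp add: add.commute lessThan_atLeast0)
  finally have eq: "comb (n + m) ?y c = comb n u c + comb m z (\<lambda>i. c (i + n))"
    by (simp add: comb_def)
  have "(comb n u c + comb m z (\<lambda>i. c (i + n))) - comb n u c \<in> W1"
    using * W0 u eq by (intro subspace_diff comb_in_subspace) auto
  then have m: "\<forall>i<m. c (i + n) = 0"
    using z unfolding indep_def by (auto dest: spec[of _ "\<lambda>i. c (i + n)"])
  then have "comb m z (\<lambda>i. c (i + n)) = 0"
    by (simp add: comb_def)
  then have "\<forall>i<n. c i = 0"
    using * u eq by (simp add: indep_def)
  then show "c i = 0"
    using m[rule_format, of "i - n"] *(2) by (cases "i < n") auto
qed

text \<open>
  A polynomial relation can be divided by \<open>x\<close> as long as its constant terms vanish, which
  they do by independence modulo \<open>xR\<close>.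
\<close>

lemma indep_imp_free:
  assumes R: "subspace R" "\<And>a b. a \<in> R \<Longrightarrow> b \<in> R \<Longrightarrow> a * b \<in> R" and x: "x \<in> R" "x \<noteq> 0"
    and u: "\<And>i. i < n \<Longrightarrow> u i \<in> R" "indep n u ((*) x ` R)"
  shows "free x n u"
  unfolding free_def
proof (intro allI impI)
  fix p i
  assume rel: "(\<Sum>i<n. ev (p i) x * u i) = 0" and i: "i < n"
  have ev_R: "ev r x * a \<in> R" if a: "a \<in> R" for r a
  proof (induction r)
    case (pCons b r)
    have "\<iota> b * a + x * (ev r x * a) \<in> R"
      using R x a pCons by (intro subspace_add subspace_scale) auto
    then show ?case
      by (simp add: algebra_simps)
  qed (use R subspace_0 in simp)
  \<comment> \<open>Induction on a strict degree bound: each round removes the constant terms and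
    one factor \<open>x\<close>.\<close>
  have "(\<forall>i<n. degree (p i) < N) \<Longrightarrow> (\<Sum>i<n. ev (p i) x * u i) = 0 \<Longrightarrow> \<forall>i<n. p i = 0" for N p
  proof (induction N arbitrary: p)
    case (Suc N)
    define a where "a i = coeff (p i) 0" for i
    define r where "r i = poly_shift 1 (p i)" for i
    have p: "p i = pCons (a i) (r i)" for i
      by (rule poly_eqI) (simp add: a_def r_def coeff_pCons coeff_poly_shift split: nat.split)
    have eq: "(\<Sum>i<n. ev (p i) x * u i) = comb n u a + x * (\<Sum>i<n. ev (r i) x * u i)"
      by (simp add: p comb_def sum_distrib_left algebra_simps sum.distrib)
    have "comb n u a = x * (- (\<Sum>i<n. ev (r i) x * u i))"
      using Suc.prems(2) unfolding eq by (simp add: eq_neg_iff_add_eq_0)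
    moreover have "- (\<Sum>i<n. ev (r i) x * u i) \<in> R"
      using R u ev_R by (intro subspace_minus subspace_sum) auto
    ultimately have a: "\<forall>i<n. a i = 0"
      using u(2) unfolding indep_def by blast
    then have "comb n u a = 0"
      by (simp add: comb_def)
    then have r_rel: "(\<Sum>i<n. ev (r i) x * u i) = 0"
      using Suc.prems(2) x unfolding eq by simp
    \<comment> \<open>Splitting a constant polynomial leaves 0, whose degree does not drop. At
      \<open>N = 0\<close> the remainders \<open>r i\<close> are therefore seen to vanish
      directly.\<close>
    show ?case
    proof (cases "N = 0")
      case True
      have "p i = 0" if "i < n" for i
      proof -
        have "degree (p i) = 0"
          using Suc.prems(1) True that by auto
        then have "r i = 0"
          by (simp add: p degree_pCons_eq_if split: if_splits)
        then show ?thesis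
          using a that p by simp
      qed
      then show ?thesis
        by blast
    next
      case False
      have "degree (r i) < N" if "i < n" for i
        using Suc.prems(1) that False by (auto simp: p degree_pCons_eq_if split: if_splits)
      then have "\<forall>i<n. r i = 0"
        using Suc.IH r_rel by blast
      then show ?thesis
        using a p by simp
    qed
  qed simp
  moreover have "\<forall>i<n. degree (p i) < Suc (Max ((\<lambda>i. degree (p i)) ` {..<n}))"
    by (auto simp: less_Suc_eq_le intro!: Max_ge)
  ultimately show "p i = 0"
    using rel i by blast
qed


section \<open>Points\<close>

text \<open>\<open>vge v m x\<close> means \<open>v x \<ge> m\<close> with the convention \<open>v 0 = \<infinity>\<close>.\<close>

definition vge :: "'a point \<Rightarrow> int \<Rightarrow> 'a \<Rightarrow> bool" where
  "vge v m x \<longleftrightarrow> x = 0 \<or> v x \<ge> m"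

lemma v_0: "v \<in> points \<iota> \<Longrightarrow> v 0 = 0"
  and v_mult: "v \<in> points \<iota> \<Longrightarrow> x \<noteq> 0 \<Longrightarrow> y \<noteq> 0 \<Longrightarrow> v (x * y) = v x + v y"
  and v_iota [simp]: "v \<in> points \<iota> \<Longrightarrow> v (\<iota> c) = 0"
  and v_uniformizer: "v \<in> points \<iota> \<Longrightarrow> \<exists>t. t \<noteq> 0 \<and> v t = 1"
  unfolding points_def by blast+

lemma v_1: "v \<in> points \<iota> \<Longrightarrow> v 1 = 0"
  using v_iota[of v 1] by simp

lemma v_inverse: "v \<in> points \<iota> \<Longrightarrow> x \<noteq> 0 \<Longrightarrow> v (inverse x) = - v x"
  using v_mult[of v x "inverse x"] v_1[of v] by simp

lemma v_divide: "v \<in> points \<iota> \<Longrightarrow> x \<noteq> 0 \<Longrightarrow> y \<noteq> 0 \<Longrightarrow> v (x / y) = v x - v y"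
  by (simp add: divide_inverse v_mult v_inverse)

lemma v_power: "v \<in> points \<iota> \<Longrightarrow> x \<noteq> 0 \<Longrightarrow> v (x ^ n) = int n * v x"
  by (induction n) (auto simp: v_1 v_mult algebra_simps)

lemma v_minus [simp]: "v \<in> points \<iota> \<Longrightarrow> v (- x) = v x"
  using v_mult[of v "\<iota> (- 1)" x] by (cases "x = 0") (auto simp del: iota_minus simp: v_iota, simp)

lemma v_power_int: "v \<in> points \<iota> \<Longrightarrow> x \<noteq> 0 \<Longrightarrow> v (x powi m) = m * v x"
  by (auto simp: power_int_def v_power v_inverse)

lemma ex_valuation: "v \<in> points \<iota> \<Longrightarrow> \<exists>t. t \<noteq> 0 \<and> v t = m"
proof -
  assume v: "v \<in> points \<iota>"
  then obtain t where "t \<noteq> 0" "v t = 1"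
    using v_uniformizer by blast
  then show ?thesis
    using v by (intro exI[of _ "t powi m"]) (simp add: v_power_int)
qed

lemma vge_0 [simp]: "vge v m 0"
  by (simp add: vge_def)

lemma vge_mono: "vge v m x \<Longrightarrow> n \<le> m \<Longrightarrow> vge v n x"
  by (auto simp: vge_def)

lemma vge_add: "v \<in> points \<iota> \<Longrightarrow> vge v m x \<Longrightarrow> vge v m y \<Longrightarrow> vge v m (x + y)"
proof -
  assume *: "v \<in> points \<iota>" "vge v m x" "vge v m y"
  have "x \<noteq> 0 \<Longrightarrow> y \<noteq> 0 \<Longrightarrow> x + y \<noteq> 0 \<Longrightarrow> min (v x) (v y) \<le> v (x + y)"
    using *(1) unfolding points_def by blast
  then show ?thesis
    using *(2,3) by (cases "x = 0"; cases "y = 0"; cases "x + y = 0") (auto simp: vge_def)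
qed

lemma vge_minus: "v \<in> points \<iota> \<Longrightarrow> vge v m x \<Longrightarrow> vge v m (- x)"
  by (simp add: vge_def)

lemma vge_diff: "v \<in> points \<iota> \<Longrightarrow> vge v m x \<Longrightarrow> vge v m y \<Longrightarrow> vge v m (x - y)"
  using vge_add[of v m x "- y"] vge_minus by simp

lemma vge_mult: "v \<in> points \<iota> \<Longrightarrow> vge v m x \<Longrightarrow> vge v n y \<Longrightarrow> vge v (m + n) (x * y)"
  by (cases "x = 0"; cases "y = 0") (auto simp: vge_def v_mult)

lemma vge_iota: "v \<in> points \<iota> \<Longrightarrow> vge v 0 (\<iota> c)"
  by (simp add: vge_def)

lemma vge_mult_iff:
  "v \<in> points \<iota> \<Longrightarrow> a \<noteq> 0 \<Longrightarrow> vge v m (a * x) \<longleftrightarrow> vge v (m - v a) x"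
  by (cases "x = 0") (auto simp: vge_def v_mult)

lemma subspace_vge: "v \<in> points \<iota> \<Longrightarrow> subspace {x. vge v m x}"
  using vge_mult[of v 0 "\<iota> _" m] by (auto simp: subspace_def vge_add vge_iota)

text \<open>A larger value of \<open>x + y\<close> would pass to \<open>x = (x + y) - y\<close>. The
  case \<open>y = 0\<close> is listed separately because it means infinite value, while
  \<open>v 0 = 0\<close> is a dummy.\<close>

lemma v_add_eq:
  assumes v: "v \<in> points \<iota>" and "x \<noteq> 0" "y = 0 \<or> v x < v y"
  shows "x + y \<noteq> 0 \<and> v (x + y) = v x"
proof (cases "y = 0")
  case False
  then have less: "v x < v y"
    using assms by blast
  have not: "\<not> vge v (v x + 1) (x + y)"
  proof
    assume "vge v (v x + 1) (x + y)"
    then have "vge v (v x + 1) ((x + y) - y)"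
      using less by (intro vge_diff[OF v]) (auto simp: vge_def)
    then show False
      using assms(2) by (simp add: vge_def)
  qed
  moreover have "vge v (v x) (x + y)"
    using less by (intro vge_add[OF v]) (auto simp: vge_def)
  ultimately show ?thesis
    by (auto simp: vge_def)
qed (use assms in simp)

lemma local_ring_eq: "local_ring v = {x. vge v 0 x}"
  by (simp add: local_ring_def vge_def)

lemma max_ideal_eq: "max_ideal v = {x. vge v 1 x}"
  by (auto simp: max_ideal_def vge_def)

lemma subspace_local_ring: "v \<in> points \<iota> \<Longrightarrow> subspace (local_ring v)"
  and subspace_max_ideal: "v \<in> points \<iota> \<Longrightarrow> subspace (max_ideal v)"
  by (simp_all add: local_ring_eq max_ideal_eq subspace_vge)

lemma v_nonzero_transcendental: "v \<in> points \<iota> \<Longrightarrow> v x \<noteq> 0 \<Longrightarrow> transcendental x"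
  by (auto simp: algebraic_iff_range)

text \<open>For a uniformizer \<open>t\<close> the maximal ideal is \<open>t\<close> times the local
  ring, so independence of residues makes a family free over \<open>k[t]\<close>. Hence
  \<open>rank t\<close> bounds the residue degree.\<close>

lemma residue_basis_exists:
  assumes v: "v \<in> points \<iota>"
  shows "\<exists>n u. basis n u (local_ring v) (max_ideal v)"
proof -
  obtain t where t: "t \<noteq> 0" "v t = 1"
    using v v_uniformizer by blast
  have "(*) t ` local_ring v = max_ideal v"
  proof (intro equalityI subsetI)
    fix x assume "x \<in> max_ideal v"
    then have "x / t \<in> local_ring v"
      using t v by (cases "x = 0") (auto simp: local_ring_def max_ideal_def v_divide)
    then show "x \<in> (*) t ` local_ring v"
      using t by (intro image_eqI[of _ _ "x / t"]) auto
  next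
    fix x assume "x \<in> (*) t ` local_ring v"
    then show "x \<in> max_ideal v"
      using vge_mult[OF v, of 1 t 0] t by (auto simp: local_ring_eq max_ideal_eq vge_def[of v 1 t])
  qed
  moreover have "transcendental t"
    using v t by (intro v_nonzero_transcendental[of v]) auto
  moreover have "a * b \<in> local_ring v" if "a \<in> local_ring v" "b \<in> local_ring v" for a b
    using that vge_mult[OF v, of 0 a 0 b] by (simp add: local_ring_eq)
  ultimately have "n \<le> rank t" if "\<And>i. i < n \<Longrightarrow> u i \<in> local_ring v" "indep n u (max_ideal v)" for n u
    using that t v subspace_local_ring
    by (intro free_le_rank[of t n u] indep_imp_free[of "local_ring v"]) (auto simp: local_ring_def)
  then show ?thesis
    using basis_exists[OF subspace_max_ideal[OF v], of "local_ring v" "rank t"] by blast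
qed

lemma basis_unique:
  assumes "subspace W" "subspace W'" "basis n u W W'" "basis m z W W'"
  shows "n = m"
  using assms indep_le_basis[of W' n u W m z] indep_le_basis[of W' m z W n u]
  by (auto simp: basis_def intro: antisym)

text \<open>Matches the definition of \<open>point_degree\<close> with indexed bases: a set of lifts
  with unique coefficients can be enumerated to a \<open>basis\<close> and conversely, and
  \<open>basis_unique\<close> makes the number under \<open>THE\<close> well defined.\<close>

lemma residue_basis:
  assumes v: "v \<in> points \<iota>"
  shows "\<exists>u. basis (point_degree \<iota> v) u (local_ring v) (max_ideal v)"
proof -
  let ?O = "local_ring v" and ?M = "max_ideal v"
  let ?Q = "\<lambda>b. finite b \<and> b \<subseteq> ?O \<and> (\<forall>x\<in>?O.
        \<exists>!c. c \<in> b \<rightarrow>\<^sub>E (UNIV :: 'k set) \<and> x - (\<Sum>s\<in>b. \<iota> (c s) * s) \<in> ?M)"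
  note M = subspace_max_ideal[OF v]
  obtain n u where B: "basis n u ?O ?M"
    using residue_basis_exists[OF v] by blast
  have comb_sum: "comb n u (c \<circ> u) = (\<Sum>s\<in>u ` {..<n}. \<iota> (c s) * s)" if "inj_on u {..<n}" for n u and c :: "'a \<Rightarrow> 'k"
    using that by (simp add: comb_def sum.reindex)
  have Q_basis: "\<exists>u. basis (card b) u ?O ?M" if b: "?Q b" for b
  proof -
    obtain u where u: "bij_betw u {..<card b} b"
      using b ex_bij_betw_nat_finite[of b] by (auto simp: lessThan_atLeast0)
    let ?n = "card b"
    have img: "u ` {..<?n} = b" and inj: "inj_on u {..<?n}"
      using u by (auto simp: bij_betw_def)
    have "indep ?n u ?M"
      unfolding indep_def
    proof (intro allI impI)
      fix c i assume *: "comb ?n u c \<in> ?M" "i < ?n"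
      define d where "d = (\<lambda>s\<in>b. c (the_inv_into {..<?n} u s))"
      have du: "d (u i) = c i" if "i < ?n" for i
        using that inj img by (auto simp: d_def the_inv_into_f_f)
      then have "comb ?n u c = comb ?n u (d \<circ> u)"
        by (intro comb_cong) simp
      \<comment> \<open>Both \<open>d\<close> and the zero family represent 0, so uniqueness of the
        coefficients of 0 forces \<open>d\<close> to be zero.\<close>
      then have "0 - (\<Sum>s\<in>b. \<iota> (d s) * s) \<in> ?M"
        using * comb_sum[OF inj, of d] img subspace_minus[OF M] by simp
      moreover have "0 - (\<Sum>s\<in>b. \<iota> ((\<lambda>s\<in>b. 0) s) * s) \<in> ?M"
        using subspace_0[OF M] by simp
      moreover have "d \<in> b \<rightarrow>\<^sub>E UNIV" "(\<lambda>s\<in>b. 0) \<in> b \<rightarrow>\<^sub>E (UNIV :: 'k set)"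
        by (auto simp: d_def)
      moreover have "0 \<in> ?O"
        by (simp add: local_ring_def)
      ultimately have "d = (\<lambda>s\<in>b. 0)"
        using b by blast
      then show "c i = 0"
        using du[OF *(2)] img *(2) by (metis imageI lessThan_iff restrict_apply')
    qed
    moreover have "\<exists>c. x - comb ?n u c \<in> ?M" if "x \<in> ?O" for x
    proof -
      obtain c where "x - (\<Sum>s\<in>b. \<iota> (c s) * s) \<in> ?M"
        using b \<open>x \<in> ?O\<close> by blast
      then show ?thesis
        using comb_sum[OF inj, of c] img by (intro exI[of _ "c \<circ> u"]) simp
    qed
    ultimately show ?thesis
      using b img unfolding basis_def by blast
  qed
  have inj: "inj_on u {..<n}"
  proof (rule inj_onI)
    fix i j assume ij: "i \<in> {..<n}" "j \<in> {..<n}" "u i = u j"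
    have eq: "comb n u (\<lambda>l. if l = i then 1 else 0) = u i" if "i < n" for i
    proof -
      have "comb n u (\<lambda>l. if l = i then 1 else 0) = (\<Sum>l<n. if l = i then u l else 0)"
        unfolding comb_def by (rule sum.cong) auto
      then show ?thesis
        using that by simp
    qed
    have "comb n u (\<lambda>l. if l = i then 1 else 0) - comb n u (\<lambda>l. if l = j then 1 else 0) \<in> ?M"
      using eq ij subspace_0[OF M] by simp
    then have "(if i = i then 1 else 0) = (if i = j then 1 else (0::'k))"
      using indep_inj[OF M] B ij unfolding basis_def by blast
    then show "i = j"
      by (simp split: if_splits)
  qed
  have "?Q (u ` {..<n})"
  proof (intro conjI ballI)
    fix x assume "x \<in> ?O"
    then obtain c where c: "x - comb n u c \<in> ?M"
      using B unfolding basis_def by blast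
    let ?d = "\<lambda>s\<in>u ` {..<n}. c (the_inv_into {..<n} u s)"
    have "comb n u c = comb n u (?d \<circ> u)"
      using inj by (intro comb_cong) (auto simp: the_inv_into_f_f)
    then have d: "x - (\<Sum>s\<in>u ` {..<n}. \<iota> (?d s) * s) \<in> ?M"
      using c unfolding comb_sum[OF inj] by simp
    show "\<exists>!c. c \<in> u ` {..<n} \<rightarrow>\<^sub>E (UNIV :: 'k set) \<and> x - (\<Sum>s\<in>u ` {..<n}. \<iota> (c s) * s) \<in> ?M"
    proof (rule ex1I[of _ ?d])
      fix e assume e: "e \<in> u ` {..<n} \<rightarrow>\<^sub>E (UNIV :: 'k set) \<and> x - (\<Sum>s\<in>u ` {..<n}. \<iota> (e s) * s) \<in> ?M"
      have "(x - (\<Sum>s\<in>u ` {..<n}. \<iota> (?d s) * s)) - (x - (\<Sum>s\<in>u ` {..<n}. \<iota> (e s) * s)) \<in> ?M"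
        by (rule subspace_diff[OF M d]) (use e in blast)
      then have "comb n u (e \<circ> u) - comb n u (?d \<circ> u) \<in> ?M"
        unfolding comb_sum[OF inj] by (simp only: diff_diff_eq2 diff_add_cancel algebra_simps) simp
      then have "\<forall>i<n. (e \<circ> u) i = (?d \<circ> u) i"
        using indep_inj[OF M] B unfolding basis_def by blast
      then show "e = ?d"
        using e by (intro PiE_ext[of e "u ` {..<n}" "\<lambda>_. UNIV"]) auto
    qed (use d in auto)
  qed (use B in \<open>auto simp: basis_def\<close>)
  moreover have "card (u ` {..<n}) = n"
    using inj by (simp add: card_image)
  ultimately have ex: "\<exists>b. finite b \<and> card b = n \<and> b \<subseteq> ?O \<and> (\<forall>x\<in>?O.
        \<exists>!c. c \<in> b \<rightarrow>\<^sub>E (UNIV :: 'k set) \<and> x - (\<Sum>s\<in>b. \<iota> (c s) * s) \<in> ?M)"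
    by blast
  have "point_degree \<iota> v = n"
    unfolding point_degree_def
  proof (rule the_equality)
    fix m assume "\<exists>b. finite b \<and> card b = m \<and> b \<subseteq> ?O \<and> (\<forall>x\<in>?O.
        \<exists>!c. c \<in> b \<rightarrow>\<^sub>E (UNIV :: 'k set) \<and> x - (\<Sum>s\<in>b. \<iota> (c s) * s) \<in> ?M)"
    then show "m = n"
      using Q_basis basis_unique[OF subspace_local_ring[OF v] M B] by blast
  qed (rule ex)
  then show ?thesis
    using B by blast
qed

lemma point_degree_pos:
  assumes v: "v \<in> points \<iota>"
  shows "point_degree \<iota> v > 0"
proof (rule ccontr)
  assume "\<not> ?thesis"
  then obtain u where "basis 0 u (local_ring v) (max_ideal v)"
    using residue_basis[OF v] by auto
  moreover have "1 \<in> local_ring v"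
    using v by (simp add: local_ring_def v_1)
  ultimately show False
    using v by (auto simp: basis_def comb_def max_ideal_def v_1)
qed


section \<open>Weak approximation for finitely many points\<close>

lemma points_eqI:
  assumes v: "v \<in> points \<iota>" and w: "w \<in> points \<iota>" and sub: "\<And>x. vge v 0 x \<Longrightarrow> vge w 0 x"
  shows "v = w"
proof -
  have unit: "w x = 0" if "x \<noteq> 0" "v x = 0" for x
  proof -
    have "vge w 0 x" "vge w 0 (inverse x)"
      using that v by (intro sub; simp add: vge_def v_inverse)+
    then show ?thesis
      using that w by (simp add: vge_def v_inverse)
  qed
  obtain t where t: "t \<noteq> 0" "v t = 1"
    using v v_uniformizer by blast
  \<comment> \<open>Dividing by a power of \<open>t\<close> makes any \<open>x\<close> a unit at
    \<open>v\<close>, hence at \<open>w\<close>. So \<open>w\<close> is a multiple of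
    \<open>v\<close>, and normalisation then forces the factor \<open>w t\<close> to be 1.\<close>
  have w_eq: "w x = v x * w t" if "x \<noteq> 0" for x
  proof -
    have "w (x / t powi v x) = 0"
      using that t v by (intro unit) (auto simp: v_divide v_power_int)
    then show ?thesis
      using that t w by (simp add: v_divide v_power_int)
  qed
  have "w t \<ge> 0"
    using sub[of t] t by (simp add: vge_def)
  moreover obtain s where "s \<noteq> 0" "w s = 1"
    using w v_uniformizer by blast
  then have "v s * w t = 1"
    using w_eq by metis
  ultimately have "w t = 1"
    by (auto simp: zmult_eq_1_iff)
  then have "v x = w x" for x
    using w_eq v_0[OF v] v_0[OF w] by (cases "x = 0") auto
  then show ?thesis
    by blast
qed

text \<open>By \<open>points_eqI\<close> neither local ring contains the other; the quotient of a
  function lying only in the first by one lying only in the second separates the points.\<close>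

lemma ex_separating2:
  assumes "v \<in> points \<iota>" "w \<in> points \<iota>" "v \<noteq> w"
  shows "\<exists>z. z \<noteq> 0 \<and> v z > 0 \<and> w z < 0"
proof -
  obtain a b where "vge v 0 a" "\<not> vge w 0 a" "vge w 0 b" "\<not> vge v 0 b"
    using points_eqI assms by metis
  then show ?thesis
    using assms by (intro exI[of _ "a / b"]) (auto simp: vge_def v_divide)
qed

lemma ex_separating:
  assumes "finite W" "W \<subseteq> points \<iota>" "v \<in> points \<iota>" "v \<notin> W"
  shows "\<exists>z. z \<noteq> 0 \<and> v z > 0 \<and> (\<forall>w\<in>W. w z < 0)"
  using assms
proof (induction W rule: finite_induct)
  case empty
  then show ?case
    using v_uniformizer[of v] by force
next
  case (insert w W)
  note v = \<open>v \<in> points \<iota>\<close>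
  have w: "w \<in> points \<iota>" and W: "W \<subseteq> points \<iota>"
    using insert by auto
  obtain z where z: "z \<noteq> 0" "v z > 0" "\<forall>u\<in>W. u z < 0"
    using insert by auto
  show ?case
  proof (cases "w z < 0")
    case False
    obtain y where y: "y \<noteq> 0" "v y > 0" "w y < 0"
      using ex_separating2[OF v w] insert by auto
    \<comment> \<open>\<open>N\<close> exceeds every pole order of \<open>z\<close> on
      \<open>W\<close>. In \<open>y ^ N + z\<close> the power then dominates at the points of
      \<open>W\<close> where \<open>y\<close> has a pole, and \<open>z\<close> dominates at the
      others; at \<open>w\<close> the power is the only term with a pole.\<close>
    define N where "N = Suc (\<Sum>u\<in>W. nat (- u z))"
    have N: "int N > - u z" if "u \<in> W" for u
    proof -
      have "nat (- u z) \<le> (\<Sum>u\<in>W. nat (- u z))"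
        using that insert by (intro member_le_sum) auto
      then show ?thesis
        unfolding N_def by linarith
    qed
    have "N > 0"
      by (simp add: N_def)
    have wN: "w (y ^ N) < 0"
      using y w \<open>N > 0\<close> by (simp add: v_power mult_pos_neg)
    then have ws: "y ^ N + z \<noteq> 0 \<and> w (y ^ N + z) = w (y ^ N)"
      using False y by (intro v_add_eq[OF w]) auto
    have "v (y ^ N) > 0"
      using y v \<open>N > 0\<close> by (simp add: v_power)
    then have "vge v 1 (y ^ N + z)"
      using z by (intro vge_add[OF v]) (auto simp: vge_def)
    then have "v (y ^ N + z) > 0"
      using ws by (simp add: vge_def)
    moreover have "u (y ^ N + z) < 0" if u: "u \<in> W" for u
    proof -
      have up: "u \<in> points \<iota>"
        using u W by blast
      have uN: "u (y ^ N) = int N * u y"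
        using up y by (simp add: v_power)
      show ?thesis
      proof (cases "u y < 0")
        case True
        then have "int N * u y \<le> int N * (- 1)"
          by (intro mult_left_mono) auto
        then have "u (y ^ N) < u z"
          using N[OF u] uN by linarith
        then show ?thesis
          using v_add_eq[OF up, of "y ^ N" z] y z u by force
      next
        case False
        then have "u z < u (y ^ N)"
          using uN z u by (smt (verit) mult_nonneg_nonneg of_nat_0_le_iff)
        then show ?thesis
          using v_add_eq[OF up, of z "y ^ N"] y z u by (force simp: add.commute)
      qed
    qed
    ultimately show ?thesis
      using ws wN by (intro exI[of _ "y ^ N + z"]) auto
  qed (use z in blast)
qed

text \<open>For a separating \<open>z\<close>, the function \<open>1 / (1 + z)\<close> is a unit at
  \<open>v\<close>, where \<open>z\<close> vanishes, and has zeros on \<open>W\<close>, where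
  \<open>z\<close> has poles; its \<open>N\<close>-th power is the witness.\<close>

lemma ex_approximation:
  assumes "finite W" "W \<subseteq> points \<iota>" "v \<in> points \<iota>" "v \<notin> W"
  shows "\<exists>e. e \<noteq> 0 \<and> v e = 0 \<and> (\<forall>w\<in>W. w e \<ge> int N)"
proof -
  obtain z where z: "z \<noteq> 0" "v z > 0" "\<forall>w\<in>W. w z < 0"
    using ex_separating[OF assms] by blast
  have v: "1 + z \<noteq> 0 \<and> v (1 + z) = 0"
    using v_add_eq[OF assms(3), of 1 z] z assms(3) by (simp add: v_1)
  have "w (inverse (1 + z) ^ N) \<ge> int N" if "w \<in> W" for w
  proof -
    have w: "w \<in> points \<iota>"
      using that assms by blast
    have "w (z + 1) = w z"
      using v_add_eq[OF w, of z 1] z w that by (simp add: v_1)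
    then have "w (inverse (1 + z)) \<ge> 1"
      using v w bspec[OF z(3) that] by (simp add: v_inverse add.commute)
    then have "int N * 1 \<le> int N * w (inverse (1 + z))"
      by (intro mult_left_mono) auto
    then show ?thesis
      using v w by (simp add: v_power)
  qed
  then show ?thesis
    using v assms by (intro exI[of _ "inverse (1 + z) ^ N"]) (auto simp: v_power v_inverse)
qed

section \<open>Semilocal rings and the degree of the zeros of a function\<close>

definition semilocal :: "'a point set \<Rightarrow> ('a point \<Rightarrow> int) \<Rightarrow> 'a set" where
  "semilocal V D = {f. \<forall>v\<in>V. vge v (D v) f}"

lemma subspace_semilocal: "V \<subseteq> points \<iota> \<Longrightarrow> subspace (semilocal V D)"
  unfolding semilocal_def subspace_def
  using vge_mult[of _ 0 "\<iota> _"] vge_iota vge_add by fastforce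

text \<open>Imposing one more zero at \<open>Q\<close> costs at least \<open>deg Q\<close>
  dimensions: lifts of a residue basis at \<open>Q\<close> are moved to order \<open>D Q\<close> by
  \<open>t\<close>, and a function \<open>e\<close> that is a unit at \<open>Q\<close> makes them
  satisfy the conditions at the other points.\<close>

lemma semilocal_step:
  assumes V: "finite V" "V \<subseteq> points \<iota>" "Q \<in> V"
  shows "\<exists>b. (\<forall>i<point_degree \<iota> Q. b i \<in> semilocal V D) \<and>
    indep (point_degree \<iota> Q) b (semilocal V (D(Q := D Q + 1)))"
proof -
  have Q: "Q \<in> points \<iota>"
    using V by blast
  obtain u where u: "basis (point_degree \<iota> Q) u (local_ring Q) (max_ideal Q)"
    using residue_basis[OF Q] by blast
  let ?n = "point_degree \<iota> Q"
  obtain t where t: "t \<noteq> 0" "Q t = D Q"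
    using ex_valuation[OF Q] by blast
  \<comment> \<open>Large enough to offset any shortfall of \<open>t * u i\<close> at the other
    points of \<open>V\<close>.\<close>
  define N where "N = (\<Sum>(w, i)\<in>V \<times> {..<?n}. nat (D w - w t - w (u i)))"
  have N: "int N \<ge> D w - w t - w (u i)" if "w \<in> V" "i < ?n" for w i
  proof -
    have "nat (D w - w t - w (u i)) = (\<lambda>(w, i). nat (D w - w t - w (u i))) (w, i)"
      by simp
    also have "\<dots> \<le> N"
      unfolding N_def using that V by (intro member_le_sum) auto
    finally show ?thesis
      by linarith
  qed
  obtain e where e: "e \<noteq> 0" "Q e = 0" "\<forall>w\<in>V - {Q}. w e \<ge> int N"
    using ex_approximation[of "V - {Q}" Q N] V Q by auto
  define b where "b i = (t * e) * u i" for i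
  have "b i \<in> semilocal V D" if i: "i < ?n" for i
    unfolding semilocal_def
  proof (intro CollectI ballI)
    fix w assume w: "w \<in> V"
    then have wp: "w \<in> points \<iota>"
      using V by blast
    show "vge w (D w) (b i)"
    proof (cases "w = Q")
      case True
      have "vge Q 0 (u i)"
        using u i by (auto simp: basis_def local_ring_eq)
      then show ?thesis
        using True t e Q by (simp add: b_def vge_mult_iff v_mult)
    next
      case False
      then have "w e \<ge> D w - w t - w (u i)"
        using e(3) w N[OF w i] by (meson DiffI empty_iff insert_iff order.trans)
      then show ?thesis
        using t e wp by (cases "u i = 0") (auto simp: b_def vge_def v_mult)
    qed
  qed
  moreover have "indep ?n b (semilocal V (D(Q := D Q + 1)))"
    unfolding indep_def
  proof (intro allI impI)
    fix c i assume *: "comb ?n b c \<in> semilocal V (D(Q := D Q + 1))" "i < ?n"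
    have "comb ?n b c = (t * e) * comb ?n u c"
      unfolding b_def by (rule comb_scale)
    then have "vge Q (D Q + 1) ((t * e) * comb ?n u c)"
      using * V by (auto simp: semilocal_def)
    then have "comb ?n u c \<in> max_ideal Q"
      using t e Q by (simp add: vge_mult_iff v_mult max_ideal_eq)
    then show "c i = 0"
      using u * by (auto simp: basis_def indep_def)
  qed
  ultimately show ?thesis
    by blast
qed

text \<open>The multiplicities are lowered one unit at a time; \<open>semilocal_step\<close>
  supplies each layer and \<open>indep_append\<close> stacks the layers.\<close>

lemma semilocal_chain:
  assumes V: "finite V" "V \<subseteq> points \<iota>"
  shows "\<exists>u. (\<forall>i<(\<Sum>v\<in>V. k v * point_degree \<iota> v). u i \<in> semilocal V (\<lambda>_. 0)) \<and>
    indep (\<Sum>v\<in>V. k v * point_degree \<iota> v) u (semilocal V (\<lambda>v. int (k v)))"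
proof (induction "\<Sum>v\<in>V. k v" arbitrary: k)
  case 0
  then have "(\<Sum>v\<in>V. k v * point_degree \<iota> v) = 0"
    using V by simp
  then show ?case
    by (simp add: indep_def)
next
  case (Suc K)
  have "\<exists>Q\<in>V. k Q \<noteq> 0"
    using Suc.hyps(2) by (metis Zero_not_Suc sum.neutral)
  then obtain Q where Q: "Q \<in> V" "k Q > 0"
    by auto
  define k' where "k' = k(Q := k Q - 1)"
  have kk': "(\<Sum>v\<in>V. k v * a v) = a Q + (\<Sum>v\<in>V. k' v * a v)" for a
  proof -
    have "(\<Sum>v\<in>V. k v * a v) = k Q * a Q + (\<Sum>v\<in>V - {Q}. k v * a v)"
      using V Q by (simp add: sum.remove)
    moreover have "(\<Sum>v\<in>V. k' v * a v) = k' Q * a Q + (\<Sum>v\<in>V - {Q}. k' v * a v)"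
      using V Q by (simp add: sum.remove)
    moreover have "(\<Sum>v\<in>V - {Q}. k' v * a v) = (\<Sum>v\<in>V - {Q}. k v * a v)"
      by (rule sum.cong) (auto simp: k'_def)
    moreover have "k Q * a Q = a Q + k' Q * a Q"
      using Q by (cases "k Q") (auto simp: k'_def)
    ultimately show ?thesis
      by simp
  qed
  let ?n = "point_degree \<iota> Q" and ?m = "\<Sum>v\<in>V. k' v * point_degree \<iota> v"
  have "K = sum k' V"
    using kk'[of "\<lambda>_. 1"] Suc.hyps(2) by simp
  then obtain z where z: "\<forall>i<?m. z i \<in> semilocal V (\<lambda>_. 0)"
      "indep ?m z (semilocal V (\<lambda>v. int (k' v)))"
    using Suc.hyps(1)[of k'] by blast
  have upd: "(\<lambda>v. int (k' v))(Q := int (k' Q) + 1) = (\<lambda>v. int (k v))"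
    using Q by (auto simp: k'_def)
  obtain b where b: "\<forall>i<?n. b i \<in> semilocal V (\<lambda>v. int (k' v))"
      "indep ?n b (semilocal V (\<lambda>v. int (k v)))"
    using semilocal_step[OF V Q(1), of "\<lambda>v. int (k' v)"] unfolding upd by blast
  have mono: "semilocal V D \<subseteq> semilocal V D'" if "\<And>v. v \<in> V \<Longrightarrow> D' v \<le> D v" for D D'
    using that unfolding semilocal_def by (auto intro: vge_mono)
  let ?y = "\<lambda>i. if i < ?n then b i else z (i - ?n)"
  have "indep (?n + ?m) ?y (semilocal V (\<lambda>v. int (k v)))"
  proof (rule indep_append[of _ "semilocal V (\<lambda>v. int (k' v))"])
    show "semilocal V (\<lambda>v. int (k v)) \<subseteq> semilocal V (\<lambda>v. int (k' v))"
      by (rule mono) (simp add: k'_def)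
    show "subspace (semilocal V (\<lambda>v. int (k' v)))"
      using V(2) by (rule subspace_semilocal)
  qed (use b z in blast)+
  moreover have "\<forall>i<?n + ?m. ?y i \<in> semilocal V (\<lambda>_. 0)"
  proof -
    have "semilocal V (\<lambda>v. int (k' v)) \<subseteq> semilocal V (\<lambda>_. 0)"
      by (rule mono) simp
    then show ?thesis
      using b(1) z(1) by auto
  qed
  ultimately show ?case
    unfolding kk'[of "point_degree \<iota>"] by (intro exI[of _ ?y] conjI)
qed

text \<open>Multiples of \<open>x\<close> in the semilocal ring vanish to order at least
  \<open>v x\<close> on \<open>V\<close>. The family from \<open>semilocal_chain\<close> is thus
  independent modulo these multiples, and hence free over \<open>k[x]\<close>.\<close>

lemma zeros_degree_le_rank:
  assumes x: "transcendental x" and V: "finite V" "V \<subseteq> points \<iota>" "\<And>v. v \<in> V \<Longrightarrow> v x > 0"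
  shows "(\<Sum>v\<in>V. nat (v x) * point_degree \<iota> v) \<le> rank x"
proof -
  let ?R = "semilocal V (\<lambda>_. 0)"
  have x0: "x \<noteq> 0"
    using x transcendental_nonzero by blast
  obtain u where u: "\<forall>i<(\<Sum>v\<in>V. nat (v x) * point_degree \<iota> v). u i \<in> ?R"
    "indep (\<Sum>v\<in>V. nat (v x) * point_degree \<iota> v) u (semilocal V (\<lambda>v. int (nat (v x))))"
    using semilocal_chain[OF V(1,2), of "\<lambda>v. nat (v x)"] by blast
  have "(*) x ` ?R \<subseteq> semilocal V (\<lambda>v. int (nat (v x)))"
    using V x0 by (force simp: semilocal_def vge_mult_iff subset_iff)
  then have "indep (\<Sum>v\<in>V. nat (v x) * point_degree \<iota> v) u ((*) x ` ?R)"
    using u(2) unfolding indep_def by blast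
  moreover have "a * b \<in> ?R" if "a \<in> ?R" "b \<in> ?R" for a b
    using that V vge_mult[of _ 0 a 0 b] by (auto simp: semilocal_def)
  moreover have "x \<in> ?R"
    using V by (auto simp: semilocal_def vge_def less_imp_le)
  ultimately have "free x (\<Sum>v\<in>V. nat (v x) * point_degree \<iota> v) u"
    using u V x0 subspace_semilocal by (intro indep_imp_free[of ?R]) auto
  then show ?thesis
    using free_le_rank[OF x] by blast
qed

text \<open>For transcendental \<open>x\<close> every zero contributes at least 1 to a sum bounded
  by \<open>rank x\<close>, so finite sets of zeros have bounded size.\<close>

lemma finite_zeros:
  assumes x: "x \<noteq> 0"
  shows "finite {v\<in>points \<iota>. v x > 0}"
proof (cases "transcendental x")
  case True
  have "card V \<le> rank x" if V: "V \<subseteq> {v\<in>points \<iota>. v x > 0}" "finite V" for V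
  proof -
    have "(\<Sum>v\<in>V. 1) \<le> (\<Sum>v\<in>V. nat (v x) * point_degree \<iota> v)"
    proof (rule sum_mono)
      fix v assume "v \<in> V"
      then have "v \<in> points \<iota>" "v x > 0"
        using V by auto
      then show "1 \<le> nat (v x) * point_degree \<iota> v"
        using point_degree_pos[of v] by (simp add: Suc_le_eq)
    qed
    also have "\<dots> \<le> rank x"
      using V by (intro zeros_degree_le_rank[OF True]) auto
    finally show ?thesis
      by simp
  qed
  then show ?thesis
    using finite_if_finite_subsets_card_bdd[of "{v\<in>points \<iota>. v x > 0}" "rank x"] by blast
next
  case False
  then have "{v\<in>points \<iota>. v x > 0} = {}"
    using v_nonzero_transcendental by fastforce
  then show ?thesis
    by (simp only: finite.emptyI)
qed

lemma finite_support:
  assumes "x \<noteq> 0"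
  shows "finite {v\<in>points \<iota>. v x \<noteq> 0}"
proof -
  have "{v\<in>points \<iota>. v x \<noteq> 0} \<subseteq> {v\<in>points \<iota>. v x > 0} \<union> {v\<in>points \<iota>. v (inverse x) > 0}"
    using assms by (auto simp: v_inverse)
  then show ?thesis
    using finite_zeros[OF assms] finite_zeros[of "inverse x"] assms
    by (meson finite_UnI finite_subset inverse_nonzero_iff_nonzero)
qed


section \<open>Existence of poles\<close>

definition subring :: "'a set \<Rightarrow> bool" where
  "subring R \<longleftrightarrow> subspace R \<and> 1 \<in> R \<and> (\<forall>a\<in>R. \<forall>b\<in>R. a * b \<in> R)"

lemma subring_subspace: "subring R \<Longrightarrow> subspace R"
  and subring_1: "subring R \<Longrightarrow> 1 \<in> R"
  and subring_mult: "subring R \<Longrightarrow> a \<in> R \<Longrightarrow> b \<in> R \<Longrightarrow> a * b \<in> R"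
  by (auto simp: subring_def)

lemma subring_iota: "subring R \<Longrightarrow> \<iota> c \<in> R"
  using subspace_scale[of R 1 c] by (simp add: subring_def)

text \<open>
  In a valuation ring, a chain of length \<open>n\<close> of strict divisors of \<open>y 0\<close> is independent
  modulo \<open>y 0\<close>.
\<close>

lemma divisor_chain_le_rank:
  assumes R: "subring R" and M: "subspace M" "\<And>a r. a \<in> M \<Longrightarrow> r \<in> R \<Longrightarrow> a * r \<in> M" "M \<subseteq> R" "1 \<notin> M"
    and y: "\<And>i. i \<le> n \<Longrightarrow> y i \<in> R \<and> y i \<noteq> 0" "\<And>i j. i < j \<Longrightarrow> j \<le> n \<Longrightarrow> y i / y j \<in> M"
  shows "n \<le> rank (y 0)"
proof (cases "n = 0")
  case False
  have iota_M: "c = 0" if "\<iota> c \<in> M" for c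
  proof (rule ccontr)
    assume "c \<noteq> 0"
    then have "\<iota> c * \<iota> (inverse c) = 1"
      by (simp flip: iota_mult)
    then show False
      using M(2)[OF that subring_iota[OF R, of "inverse c"]] M(4) by simp
  qed
  have "y 0 / y 1 * y 1 \<in> M"
    using y False R by (intro M(2)) auto
  then have "y 0 \<in> M"
    using y(1)[of 1] False by simp
  then have "transcendental (y 0)"
    using iota_M y(1)[of 0] by (auto simp: algebraic_iff_range)
  moreover have "indep n (\<lambda>i. y (Suc i)) ((*) (y 0) ` R)"
    unfolding indep_def
  proof (intro allI impI, rule ccontr)
    fix c i assume *: "comb n (\<lambda>i. y (Suc i)) c \<in> (*) (y 0) ` R" "i < n" "c i \<noteq> 0"
    \<comment> \<open>Dividing the relation by \<open>y (Suc j)\<close>, for the largest index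
      \<open>j\<close> with nonzero coefficient, puts all other terms into \<open>M\<close>, and
      with them the nonzero constant \<open>\<iota> (c j)\<close>.\<close>
    define j where "j = Max {i. i < n \<and> c i \<noteq> 0}"
    have j: "j < n" "c j \<noteq> 0"
      using Max_in[of "{i. i < n \<and> c i \<noteq> 0}"] * unfolding j_def[symmetric] by auto
    have above: "c i = 0" if "j < i" "i < n" for i
      using Max_ge[of "{i. i < n \<and> c i \<noteq> 0}" i] that unfolding j_def by fastforce
    obtain r where r: "comb n (\<lambda>i. y (Suc i)) c = y 0 * r" "r \<in> R"
      using * by blast
    have "comb n (\<lambda>i. y (Suc i)) c = (\<Sum>i<Suc j. \<iota> (c i) * y (Suc i))"
      unfolding comb_def using j above by (intro sum.mono_neutral_right) auto
    then have eq: "\<iota> (c j) * y (Suc j) = y 0 * r - (\<Sum>i<j. \<iota> (c i) * y (Suc i))"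
      using r by simp
    have "\<iota> (c j) = (\<iota> (c j) * y (Suc j)) / y (Suc j)"
      using y(1)[of "Suc j"] j by simp
    also have "\<dots> = y 0 / y (Suc j) * r - (\<Sum>i<j. \<iota> (c i) * (y (Suc i) / y (Suc j)))"
      unfolding eq by (simp add: diff_divide_distrib sum_divide_distrib)
    also have "\<dots> \<in> M"
      using y(2) j r M by (intro subspace_diff subspace_sum subspace_scale M(2)) auto
    finally show False
      using iota_M j by blast
  qed
  ultimately show ?thesis
    using R y(1) by (intro free_le_rank[of _ n "\<lambda>i. y (Suc i)"] indep_imp_free[of R])
      (auto simp: subring_def)
qed simp

text \<open>Valuation rings of the function field are discrete: \<open>divisor_chain_le_rank\<close>
  excludes long chains of divisors, so the ideal \<open>M\<close> of nonunits is generated by one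
  \<open>t\<close> and every nonzero element of \<open>R\<close> has finite order in
  \<open>t\<close>. The required point is this order.\<close>

lemma valuation_ring_point:
  assumes R: "subring R" and val: "\<And>z. z \<in> R \<or> inverse z \<in> R"
    and g: "g \<noteq> 0" "inverse g \<notin> R"
  shows "\<exists>v\<in>points \<iota>. v g > 0"
proof -
  note RS = subring_subspace[OF R]
  define M where "M = {x. x = 0 \<or> inverse x \<notin> R}"
  have MR: "M \<subseteq> R"
    using val subspace_0[OF RS] by (auto simp: M_def)
  have M1: "1 \<notin> M"
    using subring_1[OF R] by (simp add: M_def)
  have M_mult: "a * r \<in> M" if "a \<in> M" "r \<in> R" for a r
  proof (rule ccontr)
    assume "a * r \<notin> M"
    then have *: "a \<noteq> 0" "r \<noteq> 0" "inverse (a * r) \<in> R"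
      by (auto simp: M_def)
    then have "inverse (a * r) * r \<in> R"
      using that R subring_mult by blast
    then have "inverse a \<in> R"
      using * by (simp add: mult.assoc)
    then show False
      using that * by (simp add: M_def)
  qed
  have M_add': "a + b \<in> M" if "a \<in> M" "b \<in> M" "b \<noteq> 0" "a / b \<in> R" for a b
  proof -
    have "b * (a / b + 1) \<in> M"
      using that R RS by (intro M_mult subspace_add subring_1) auto
    moreover have "b * (a / b + 1) = a + b"
      using that by (simp add: field_simps)
    ultimately show ?thesis
      by simp
  qed
  have M: "subspace M"
    unfolding subspace_def
  proof (intro conjI ballI allI)
    fix a b assume ab: "a \<in> M" "b \<in> M"
    show "a + b \<in> M"
    proof (cases "a = 0 \<or> b = 0")
      case False
      have "a / b \<in> R \<or> b / a \<in> R"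
        using val[of "a / b"] by simp
      then show ?thesis
        using M_add'[of a b] M_add'[of b a] ab False by (auto simp: add.commute)
    qed (use ab in auto)
  next
    fix c a assume "a \<in> M"
    then show "\<iota> c * a \<in> M"
      using M_mult[of a "\<iota> c"] subring_iota[OF R] by (simp add: mult.commute)
  qed (simp add: M_def)
  have gM: "g \<in> M"
    using g by (simp add: M_def)
  note chain = divisor_chain_le_rank[OF R M M_mult MR M1]
  \<comment> \<open>If no generator existed, each nonzero \<open>t\<close> in \<open>M\<close> would
    be a proper multiple of another nonunit \<open>h t\<close>; iterating \<open>h\<close> from
    \<open>g\<close> yields a chain longer than \<open>rank g\<close>.\<close>
  have "\<exists>t\<in>M. t \<noteq> 0 \<and> (\<forall>y\<in>M. y / t \<in> R)"
  proof (rule ccontr)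
    assume no: "\<not> ?thesis"
    have "\<exists>y\<in>M. y \<noteq> 0 \<and> t / y \<in> M" if t: "t \<in> M" "t \<noteq> 0" for t
    proof -
      obtain y where y: "y \<in> M" "y / t \<notin> R"
        using no t by blast
      then have "y \<noteq> 0" "t / y \<in> M"
        using subspace_0[OF RS] by (auto simp: M_def)
      then show ?thesis
        using y by blast
    qed
    then obtain h where h: "\<And>t. t \<in> M \<Longrightarrow> t \<noteq> 0 \<Longrightarrow> h t \<in> M \<and> h t \<noteq> 0 \<and> t / h t \<in> M"
      by metis
    define y where "y i = (h ^^ i) g" for i
    have y: "y i \<in> M \<and> y i \<noteq> 0" for i
      by (induction i) (use g gM h in \<open>auto simp: y_def\<close>)
    have y_Suc: "y i / y (Suc i) \<in> M" for i
      using h y[of i] by (simp add: y_def)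
    have "y i / y j \<in> M" if "i < j" for i j
      using that
    proof (induction j)
      case (Suc j)
      show ?case
      proof (cases "i = j")
        case False
        then have "y i / y j * (y j / y (Suc j)) \<in> M"
          using Suc y_Suc MR by (intro M_mult) auto
        then show ?thesis
          using y[of j] by simp
      qed (use y_Suc in simp)
    qed simp
    then have "Suc (rank g) \<le> rank (y 0)"
      using y MR by (intro chain) auto
    then show False
      by (simp add: y_def)
  qed
  then obtain t where t: "t \<in> M" "t \<noteq> 0" and tM: "\<And>y. y \<in> M \<Longrightarrow> y / t \<in> R"
    by blast
  have t_power: "t ^ Suc n \<in> M" for n
    by (induction n) (use t M_mult MR in \<open>auto simp: mult.commute\<close>)
  have R_power: "t ^ n \<in> R" for n
    using t_power[of "n - 1"] MR subring_1[OF R] by (cases n) auto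
  have finite_order: "\<exists>n. z / t ^ n \<notin> R" if z: "z \<in> R" "z \<noteq> 0" for z
  proof (rule ccontr)
    assume no: "\<not> ?thesis"
    define n where "n = Suc (rank z)"
    \<comment> \<open>The chain \<open>z\<close>, \<open>t ^ (n - 1)\<close>, ..., \<open>t\<close>,
      \<open>1\<close>: if all powers of \<open>t\<close> divided \<open>z\<close>, its length would
      exceed \<open>rank z\<close>.\<close>
    define y where "y j = (if j = 0 then z else t ^ (n - j))" for j
    have "y i \<in> R \<and> y i \<noteq> 0" for i
      using z t R_power by (simp add: y_def)
    moreover have "y i / y j \<in> M" if ij: "i < j" "j \<le> n" for i j
    proof (cases "i = 0")
      case True
      have "t * (z / t ^ Suc (n - j)) \<in> M"
        using no t by (intro M_mult) blast+
      then show ?thesis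
        using True ij t by (simp add: y_def)
    next
      case False
      have "t ^ (n - i) = t ^ (n - j) * t ^ Suc (j - i - 1)"
        unfolding power_add[symmetric] using ij by (intro arg_cong[of _ _ "(^) t"]) simp
      then show ?thesis
        using False ij t t_power[of "j - i - 1"] by (simp add: y_def)
    qed
    ultimately have "n \<le> rank (y 0)"
      by (intro chain) auto
    then show False
      by (simp add: y_def n_def)
  qed
  define U where "U = {u. u \<noteq> 0 \<and> u \<in> R \<and> inverse u \<in> R}"
  have U_mult: "a * b \<in> U" if "a \<in> U" "b \<in> U" for a b
    using that R by (auto simp: U_def subring_mult)
  have U_inverse: "inverse a \<in> U" if "a \<in> U" for a
    using that by (auto simp: U_def)
  have not_U: "t powi n \<notin> U" if "n > 0" for n
  proof -
    have "t powi n = t ^ Suc (nat n - 1)"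
      using that by (simp add: power_int_def del: power_Suc)
    then have "t powi n \<in> M"
      using t_power by simp
    then show ?thesis
      by (auto simp: U_def M_def)
  qed
  have ex_R: "\<exists>n. x / t powi n \<in> U" if x: "x \<in> R" "x \<noteq> 0" for x
  proof -
    \<comment> \<open>The first power of \<open>t\<close> that fails to divide \<open>x\<close>; the
      quotient by the preceding power lies in \<open>R\<close> but not in \<open>M\<close>, so it is
      a unit.\<close>
    define n where "n = (LEAST n. x / t ^ n \<notin> R)"
    have n: "x / t ^ n \<notin> R" "\<And>m. m < n \<Longrightarrow> x / t ^ m \<in> R"
      unfolding n_def using LeastI_ex[OF finite_order[OF x]] by (auto dest: not_less_Least)
    then obtain m where m: "n = Suc m"
      using x by (cases n) auto
    have "x / t ^ m / t \<notin> R"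
      using n(1) m by (simp add: mult.commute)
    then have "x / t ^ m \<notin> M"
      using tM by blast
    then have "x / t powi int m \<in> U"
      using n(2)[of m] m by (auto simp: U_def M_def)
    then show ?thesis
      by blast
  qed
  have ex: "\<exists>n. x / t powi n \<in> U" if x: "x \<noteq> 0" for x
  proof (cases "x \<in> R")
    case False
    then have "inverse x \<in> R"
      using val by blast
    then obtain n where "inverse x / t powi n \<in> U"
      using ex_R[of "inverse x"] x by auto
    then have "inverse (inverse x / t powi n) \<in> U"
      by (rule U_inverse)
    then have "x / t powi (- n) \<in> U"
      by (simp add: power_int_minus field_simps)
    then show ?thesis
      by blast
  qed (use ex_R x in blast)
  define v where "v x = (if x = 0 then 0 else THE n. x / t powi n \<in> U)" for x
  have uniq': "\<not> n < m" if "x / t powi n \<in> U" "x / t powi m \<in> U" for x n m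
  proof
    assume "n < m"
    have "(x / t powi n) * inverse (x / t powi m) \<in> U"
      using that U_mult U_inverse by blast
    moreover have "(x / t powi n) * inverse (x / t powi m) = t powi (m - n)"
      using that t by (auto simp: power_int_diff U_def field_simps)
    ultimately show False
      using not_U[of "m - n"] \<open>n < m\<close> by simp
  qed
  have uniq: "n = m" if "x / t powi n \<in> U" "x / t powi m \<in> U" for x n m
    using uniq'[OF that] uniq'[OF that(2,1)] by simp
  have v_eq: "v x = n" if "x / t powi n \<in> U" for x n
  proof -
    have "x \<noteq> 0"
      using that by (auto simp: U_def)
    then show ?thesis
      unfolding v_def using that uniq by auto
  qed
  have v_U: "x / t powi v x \<in> U" if "x \<noteq> 0" for x
    using ex[OF that] v_eq by blast
  have mult: "v (x * y) = v x + v y" if "x \<noteq> 0" "y \<noteq> 0" for x y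
  proof (rule v_eq)
    have "(x / t powi v x) * (y / t powi v y) \<in> U"
      using v_U that by (intro U_mult) auto
    then show "x * y / t powi (v x + v y) \<in> U"
      using t by (simp add: power_int_add)
  qed
  have t_powi_R: "t powi n \<in> R" if "n \<ge> 0" for n
    using that R_power by (simp add: power_int_def)
  have v_nonneg: "v x \<ge> 0 \<longleftrightarrow> x \<in> R" if x: "x \<noteq> 0" for x
  proof
    assume "v x \<ge> 0"
    then have "t powi v x * (x / t powi v x) \<in> R"
      using v_U[OF x] t_powi_R R by (intro subring_mult) (auto simp: U_def)
    then show "x \<in> R"
      using t by simp
  next
    assume xR: "x \<in> R"
    show "v x \<ge> 0"
    proof (rule ccontr)
      assume neg: "\<not> ?thesis"
      have "t powi (- v x - 1) * x * inverse (x / t powi v x) \<in> R"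
        using neg v_U[OF x] t_powi_R[of "- v x - 1"] xR R
        by (intro subring_mult) (auto simp: U_def)
      moreover have "t powi (- v x - 1) * x * inverse (x / t powi v x) = inverse t"
        using x t by (simp add: power_int_diff power_int_minus field_simps)
      ultimately show False
        using t by (auto simp: M_def)
    qed
  qed
  have inv: "v (inverse x) = - v x" if "x \<noteq> 0" for x
  proof -
    have "1 / t powi 0 \<in> U"
      using subring_1[OF R] by (simp add: U_def)
    then have "v 1 = 0"
      by (rule v_eq)
    then show ?thesis
      using mult[of x "inverse x"] that by simp
  qed
  have add': "v x \<le> v (x + y)" if xy: "x \<noteq> 0" "y \<noteq> 0" "x + y \<noteq> 0" "v x \<le> v y" for x y
  proof -
    have "v (y * inverse x) \<ge> 0"
      using xy by (simp add: mult inv)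
    then have "y * inverse x \<in> R"
      using xy v_nonneg[of "y * inverse x"] by simp
    then have "1 + y * inverse x \<in> R"
      using subspace_add[OF RS] subring_1[OF R] by blast
    moreover have "1 + y * inverse x = (x + y) * inverse x"
      using xy by (simp add: field_simps)
    ultimately have "v ((x + y) * inverse x) \<ge> 0"
      using v_nonneg[of "(x + y) * inverse x"] xy by simp
    then show ?thesis
      using xy by (simp add: mult inv)
  qed
  have add: "min (v x) (v y) \<le> v (x + y)" if "x \<noteq> 0" "y \<noteq> 0" "x + y \<noteq> 0" for x y
    using add'[of x y] add'[of y x] that by (cases "v x \<le> v y") (auto simp: add.commute)
  have const: "v (\<iota> c) = 0" for c
  proof (cases "c = 0")
    case False
    then have "\<iota> c / t powi 0 \<in> U"
      using subring_iota[OF R, of c] subring_iota[OF R, of "inverse c"]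
      by (simp add: U_def iota_inverse)
    then show ?thesis
      by (rule v_eq)
  qed (simp add: v_def)
  have "t / t powi 1 \<in> U"
    using t subring_1[OF R] by (simp add: U_def)
  then have "v t = 1"
    by (rule v_eq)
  then have "v \<in> points \<iota>"
    unfolding points_def using mult add const t by (auto simp: v_def[of 0])
  moreover have "v g > 0"
    using v_nonneg[of g] v_nonneg[of "inverse g"] inv[of g] g gM MR by auto
  ultimately show ?thesis
    by blast
qed

text \<open>Chevalley's argument: a subring maximal without \<open>f\<close> but containing \<open>1/f\<close> is a valuation ring.\<close>

lemma ex_pole:
  assumes f: "transcendental f"
  shows "\<exists>v\<in>points \<iota>. v f < 0"
proof -
  define g where "g = inverse f"
  have f0: "f \<noteq> 0" and g0: "g \<noteq> 0"
    using transcendental_nonzero[OF f] by (auto simp: g_def)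
  have g: "transcendental g"
    using transcendental_inverse[OF f] by (simp add: g_def)
  define \<A> where "\<A> = {R. subring R \<and> g \<in> R \<and> f \<notin> R}"
  have "range (\<lambda>p. ev p g) \<in> \<A>"
  proof -
    have "subring (range (\<lambda>p. ev p g))"
      unfolding subring_def subspace_def
    proof (intro conjI ballI allI)
      show "0 \<in> range (\<lambda>p. ev p g)"
        by (rule range_eqI[of _ _ 0]) simp
      show "1 \<in> range (\<lambda>p. ev p g)"
        by (rule range_eqI[of _ _ 1]) simp
    qed (auto simp flip: ev_add ev_mult ev_smult)
    moreover have "g \<in> range (\<lambda>p. ev p g)"
      by (rule range_eqI[of _ _ "[:0, 1:]"]) simp
    moreover have "f \<noteq> ev p g" for p
    proof
      assume "f = ev p g"
      \<comment> \<open>Multiplying by \<open>g = 1 / f\<close> turns an expression of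
        \<open>f\<close> as a polynomial in \<open>g\<close> into an algebraic relation for
        \<open>g\<close>.\<close>
      then have "ev (pCons (- 1) p) g = 0"
        using f0 by (simp add: g_def)
      then show False
        using transcendental_ev_eq_0[OF g] pCons_eq_0_iff by (metis neg_equal_0_iff_equal zero_neq_one)
    qed
    ultimately show ?thesis
      by (auto simp: \<A>_def)
  qed
  then have "\<A> \<noteq> {}"
    by blast
  then have "\<exists>R\<in>\<A>. \<forall>X\<in>\<A>. R \<subseteq> X \<longrightarrow> X = R"
  proof (rule subset_Zorn_nonempty)
    fix \<C> assume \<C>: "\<C> \<noteq> {}" "subset.chain \<A> \<C>"
    have sub: "\<C> \<subseteq> \<A>" and tot: "\<And>X Y. X \<in> \<C> \<Longrightarrow> Y \<in> \<C> \<Longrightarrow> X \<subseteq> Y \<or> Y \<subseteq> X"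
      using \<C> by (auto simp: subset_chain_def)
    have common: "\<exists>X\<in>\<C>. a \<in> X \<and> b \<in> X" if "a \<in> \<Union>\<C>" "b \<in> \<Union>\<C>" for a b
      using that tot by (metis UnionE subsetD)
    have props: "0 \<in> X" "1 \<in> X" "g \<in> X" "f \<notin> X" "\<And>a b. a \<in> X \<Longrightarrow> b \<in> X \<Longrightarrow> a + b \<in> X"
      "\<And>a b. a \<in> X \<Longrightarrow> b \<in> X \<Longrightarrow> a * b \<in> X" "\<And>a c. a \<in> X \<Longrightarrow> \<iota> c * a \<in> X" if "X \<in> \<C>" for X
      using that sub by (auto simp: \<A>_def subring_def subspace_def)
    obtain X where X: "X \<in> \<C>"
      using \<C> by blast
    show "\<Union>\<C> \<in> \<A>"
      unfolding \<A>_def subring_def subspace_def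
    proof (intro CollectI conjI ballI allI)
      show "0 \<in> \<Union>\<C>" "1 \<in> \<Union>\<C>" "g \<in> \<Union>\<C>"
        using props(1-3)[OF X] X by blast+
      show "f \<notin> \<Union>\<C>"
        using props(4) by blast
    next
      fix c a assume "a \<in> \<Union>\<C>"
      then show "\<iota> c * a \<in> \<Union>\<C>"
        using props(7) by blast
    next
      fix a b assume "a \<in> \<Union>\<C>" "b \<in> \<Union>\<C>"
      then obtain Y where "Y \<in> \<C>" "a \<in> Y" "b \<in> Y"
        using common by blast
      then show "a + b \<in> \<Union>\<C>" "a * b \<in> \<Union>\<C>"
        using props(5,6) by blast+
    qed
  qed
  then obtain R where R: "subring R" "g \<in> R" "f \<notin> R"
    and max: "\<And>X. subring X \<Longrightarrow> g \<in> X \<Longrightarrow> f \<notin> X \<Longrightarrow> R \<subseteq> X \<Longrightarrow> X = R"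
    unfolding \<A>_def by blast
  note RS = subring_subspace[OF R(1)]
  \<comment> \<open>The ideal generated by \<open>g\<close>. It is proper because
    \<open>1 = g * r\<close> would give \<open>f = r\<close>, an element of
    \<open>R\<close>.\<close>
  define I where "I = (*) g ` R"
  have I_0: "0 \<in> I"
    using subspace_0[OF RS] by (force simp: I_def)
  have I_add: "a + b \<in> I" if ab: "a \<in> I" "b \<in> I" for a b
  proof -
    obtain a' b' where "a = g * a'" "b = g * b'" "a' \<in> R" "b' \<in> R"
      using ab by (auto simp: I_def)
    then show ?thesis
      using subspace_add[OF RS] unfolding I_def by (intro image_eqI[of _ _ "a' + b'"]) (auto simp: algebra_simps)
  qed
  have I_mult: "r * a \<in> I" if ra: "r \<in> R" "a \<in> I" for r a
  proof -
    obtain a' where "a = g * a'" "a' \<in> R"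
      using ra by (auto simp: I_def)
    then show ?thesis
      using subring_mult[OF R(1)] ra unfolding I_def by (intro image_eqI[of _ _ "r * a'"]) auto
  qed
  have IR: "I \<subseteq> R"
    using R subring_mult by (auto simp: I_def)
  have I_1: "1 \<notin> I"
  proof
    assume "1 \<in> I"
    then obtain r where "1 = g * r" "r \<in> R"
      by (auto simp: I_def)
    then have "f = r"
      using f0 by (simp add: g_def field_simps)
    then show False
      using R \<open>r \<in> R\<close> by simp
  qed
  \<comment> \<open>Relations \<open>1 = p(z)\<close> with coefficients in \<open>I\<close>. For
    \<open>z\<close> outside \<open>R\<close> one exists: maximality puts \<open>f\<close> into
    \<open>R[z]\<close>, and multiplying an expression for \<open>f\<close> by \<open>g\<close>
    gives it.\<close>
  define S where "S z = {p. (\<forall>i. coeff p i \<in> I) \<and> poly p z = 1}" for z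
  have S_nonempty: "S z \<noteq> {}" if z: "z \<notin> R" for z
  proof -
    define X where "X = (\<lambda>p. poly p z) ` {p. \<forall>i. coeff p i \<in> R}"
    have "subring X"
      unfolding subring_def subspace_def
    proof (intro conjI ballI allI)
      show "0 \<in> X"
        unfolding X_def using subspace_0[OF RS] by (intro image_eqI[of _ _ 0]) auto
      show "1 \<in> X"
        unfolding X_def using subring_1[OF R(1)] subspace_0[OF RS]
        by (intro image_eqI[of _ _ 1]) (auto simp: coeff_1)
    next
      fix a b assume "a \<in> X" "b \<in> X"
      then obtain p r where *: "a = poly p z" "b = poly r z" "\<forall>i. coeff p i \<in> R" "\<forall>i. coeff r i \<in> R"
        by (auto simp: X_def)
      then show "a + b \<in> X"
        unfolding X_def using subspace_add[OF RS] by (intro image_eqI[of _ _ "p + r"]) auto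
      show "a * b \<in> X"
        unfolding X_def using * subring_mult[OF R(1)]
        by (intro image_eqI[of _ _ "p * r"]) (auto simp: coeff_mult intro!: subspace_sum[OF RS])
    next
      fix c a assume "a \<in> X"
      then obtain p where "a = poly p z" "\<forall>i. coeff p i \<in> R"
        by (auto simp: X_def)
      then show "\<iota> c * a \<in> X"
        unfolding X_def using subspace_scale[OF RS] by (intro image_eqI[of _ _ "smult (\<iota> c) p"]) auto
    qed
    moreover have RX: "R \<subseteq> X"
    proof
      fix r assume "r \<in> R"
      then show "r \<in> X"
        unfolding X_def using subspace_0[OF RS]
        by (intro image_eqI[of _ _ "[:r:]"]) (auto simp: coeff_pCons split: nat.split)
    qed
    moreover have "z \<in> X"
      unfolding X_def using subring_1[OF R(1)] subspace_0[OF RS]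
      by (intro image_eqI[of _ _ "[:0, 1:]"]) (auto simp: coeff_pCons split: nat.split)
    ultimately have "f \<in> X"
      using max[of X] R z by blast
    then obtain p where p: "f = poly p z" "\<forall>i. coeff p i \<in> R"
      by (auto simp: X_def)
    then have "smult g p \<in> S z"
      using f0 by (auto simp: S_def I_def g_def)
    then show ?thesis
      by blast
  qed
  have reduce: "\<exists>p'\<in>S z. degree p' < degree p"
    if z: "z \<noteq> 0" and p: "p \<in> S z" and r: "r \<in> S (inverse z)" and le: "degree r \<le> degree p" for z p r
  proof -
    let ?n = "degree p"
    have pI: "\<And>i. coeff p i \<in> I" and p1: "poly p z = 1"
      using p by (auto simp: S_def)
    have rI: "\<And>i. coeff r i \<in> I" and r1: "poly r (inverse z) = 1"
      using r by (auto simp: S_def)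
    have n: "?n > 0"
    proof (rule ccontr)
      assume "\<not> ?thesis"
      then obtain a where "p = [:a:]"
        by (auto elim: degree_eq_zeroE)
      then show False
        using pI[of 0] p1 I_1 by simp
    qed
    define b where "b = coeff r 0"
    define a where "a = coeff p ?n"
    define p1' where "p1' = (\<Sum>i<?n. monom (coeff p i) i)"
    \<comment> \<open>Multiplying \<open>r(1 / z) = 1\<close> by \<open>z ^ n\<close> reverses
      \<open>r\<close>. Apart from the constant term \<open>b\<close> this leaves
      \<open>r1'\<close>, so that \<open>(1 - b) z ^ n = r1'(z)\<close>.\<close>
    define r1' where "r1' = (\<Sum>j\<in>{1..?n}. monom (coeff r j) (?n - j))"
    have "poly p z = (\<Sum>i<?n. coeff p i * z ^ i) + a * z ^ ?n"
      by (simp add: poly_altdef a_def lessThan_Suc_atMost[symmetric])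
    then have pz: "poly p1' z + a * z ^ ?n = 1"
      using p1 by (simp add: p1'_def poly_sum poly_monom)
    have "poly r (inverse z) = (\<Sum>j\<le>?n. coeff r j * inverse z ^ j)"
      unfolding poly_altdef using le by (intro sum.mono_neutral_left) (auto simp: coeff_eq_0)
    then have "z ^ ?n = (\<Sum>j\<le>?n. coeff r j * z ^ (?n - j))"
    proof -
      assume "poly r (inverse z) = (\<Sum>j\<le>?n. coeff r j * inverse z ^ j)"
      then have "z ^ ?n = z ^ ?n * (\<Sum>j\<le>?n. coeff r j * inverse z ^ j)"
        using r1 by simp
      also have "\<dots> = (\<Sum>j\<le>?n. coeff r j * z ^ (?n - j))"
        unfolding sum_distrib_left
        using z by (intro sum.cong) (auto simp: power_diff power_inverse field_simps)
      finally show ?thesis .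
    qed
    also have "{..?n} = insert 0 {1..?n}"
      by auto
    finally have rz: "z ^ ?n = b * z ^ ?n + poly r1' z"
      by (simp add: r1'_def b_def poly_sum poly_monom)
    \<comment> \<open>Multiply \<open>1 = p1'(z) + a z ^ n\<close> by \<open>1 - b\<close> and
      replace \<open>(1 - b) z ^ n\<close> by \<open>r1'(z)\<close>: the leading term
      disappears.\<close>
    define p' where "p' = [:b:] + smult a r1' + smult (1 - b) p1'"
    have "poly p' z = 1"
    proof -
      have "poly p1' z = 1 - a * z ^ ?n" "poly r1' z = z ^ ?n - b * z ^ ?n"
        using pz rz by (simp_all only: eq_diff_eq add.commute)
      then have "poly p' z = b + a * (z ^ ?n - b * z ^ ?n) + (1 - b) * (1 - a * z ^ ?n)"
        by (simp add: p'_def)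
      also have "\<dots> = 1"
        by (simp add: algebra_simps)
      finally show ?thesis .
    qed
    moreover have "coeff p' i \<in> I" for i
    proof -
      have I_sum: "(\<Sum>j\<in>A. h j) \<in> I" if "\<And>j. j \<in> A \<Longrightarrow> h j \<in> I" for A and h :: "nat \<Rightarrow> 'a"
        using that by (induction A rule: infinite_finite_induct) (auto intro: I_0 I_add)
      have "coeff p1' i \<in> I" "coeff r1' i \<in> I"
        unfolding p1'_def r1'_def coeff_sum using pI rI I_0 by (auto intro!: I_sum)
      moreover have "a \<in> R" "1 - b \<in> R"
        using pI rI IR subring_1[OF R(1)] by (auto simp: a_def b_def intro: subspace_diff[OF RS])
      moreover have "coeff [:b:] i \<in> I"
        using rI I_0 by (auto simp: b_def coeff_pCons split: nat.split)
      ultimately show ?thesis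
        unfolding p'_def by (simp only: coeff_add coeff_smult) (intro I_add I_mult)
    qed
    moreover have "degree p' < ?n"
    proof -
      have "degree p1' \<le> ?n - 1"
        unfolding p1'_def by (intro degree_sum_le) (auto intro: order.trans[OF degree_monom_le])
      moreover have "degree r1' \<le> ?n - 1"
        unfolding r1'_def by (intro degree_sum_le) (auto intro: order.trans[OF degree_monom_le])
      ultimately have "degree p' \<le> ?n - 1"
        unfolding p'_def
        by (intro degree_add_le order.trans[OF degree_smult_le]) auto
      then show ?thesis
        using n by simp
    qed
    ultimately show ?thesis
      unfolding S_def by blast
  qed
  have "z \<in> R \<or> inverse z \<in> R" for z
  proof (rule ccontr)
    assume no: "\<not> ?thesis"
    then have z: "z \<noteq> 0"
      using subspace_0[OF RS] by auto
    \<comment> \<open>Of two relations, one for \<open>z\<close> and one for \<open>1 / z\<close>,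
      the one of larger degree can always be shortened; the sum of the degrees cannot descend
      forever.\<close>
    have no_pair: "p \<in> S z \<Longrightarrow> r \<in> S (inverse z) \<Longrightarrow> False" for p r
    proof (induction "degree p + degree r" arbitrary: p r rule: less_induct)
      case less
      show False
      proof (cases "degree r \<le> degree p")
        case True
        then show False
          using reduce[OF z less.prems] less.hyps less.prems(2) by force
      next
        case False
        then show False
          using reduce[of "inverse z" r p] z less.prems less.hyps by force
      qed
    qed
    have "S z \<noteq> {}" "S (inverse z) \<noteq> {}"
      using S_nonempty no by auto
    then show False
      using no_pair by blast
  qed
  then obtain v where v: "v \<in> points \<iota>" "v g > 0"
    using valuation_ring_point[OF R(1), of g] g0 R(3) by (auto simp: g_def)
  then have "v f < 0"
    using f0 by (simp add: g_def v_inverse)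
  then show ?thesis
    using v by blast
qed


section \<open>Divisors and their spaces of functions\<close>

abbreviation coef :: "'a divisor \<Rightarrow> 'a point \<Rightarrow> int" where
  "coef \<equiv> Poly_Mapping.lookup"

abbreviation "Div \<equiv> divisors \<iota>"

abbreviation "deg \<equiv> degree_divisor \<iota>"

abbreviation "L \<equiv> L_space \<iota>"

abbreviation pt :: "'a point \<Rightarrow> int \<Rightarrow> 'a divisor" where
  "pt \<equiv> Poly_Mapping.single"

definition effective :: "'a divisor \<Rightarrow> bool" where
  "effective D \<longleftrightarrow> D \<in> Div \<and> (\<forall>v. coef D v \<ge> 0)"

lemma divisors_0: "0 \<in> Div"
  by (simp add: divisors_def)

lemma divisors_iff: "D \<in> Div \<longleftrightarrow> (\<forall>v. coef D v \<noteq> 0 \<longrightarrow> v \<in> points \<iota>)"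
  by (auto simp: divisors_def in_keys_iff)

lemma divisors_add: "D \<in> Div \<Longrightarrow> E \<in> Div \<Longrightarrow> D + E \<in> Div"
  unfolding divisors_iff lookup_add by (metis add_0)

lemma divisors_minus: "D \<in> Div \<Longrightarrow> - D \<in> Div"
  by (simp add: divisors_iff)

lemma divisors_diff: "D \<in> Div \<Longrightarrow> E \<in> Div \<Longrightarrow> D - E \<in> Div"
  unfolding divisors_iff lookup_minus by (metis diff_0_right)

lemma divisors_pt: "v \<in> points \<iota> \<Longrightarrow> pt v m \<in> Div"
  by (auto simp: divisors_iff lookup_single when_def)

lemmas divisors_intros = divisors_0 divisors_add divisors_minus divisors_diff divisors_pt

lemma degree_superset:
  assumes "finite S" "Poly_Mapping.keys D \<subseteq> S"
  shows "deg D = (\<Sum>v\<in>S. coef D v * int (point_degree \<iota> v))"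
  unfolding degree_divisor_def using assms
  by (intro sum.mono_neutral_left) (auto simp: in_keys_iff)

lemma degree_0 [simp]: "deg 0 = 0"
  by (simp add: degree_divisor_def)

lemma degree_add [simp]: "deg (D + E) = deg D + deg E"
proof -
  let ?S = "Poly_Mapping.keys D \<union> Poly_Mapping.keys E"
  have "deg (D + E) = (\<Sum>v\<in>?S. coef (D + E) v * int (point_degree \<iota> v))"
    using Poly_Mapping.keys_add[of D E] by (intro degree_superset) auto
  also have "\<dots> = deg D + deg E"
    using degree_superset[of ?S D] degree_superset[of ?S E]
    by (simp add: lookup_add algebra_simps sum.distrib)
  finally show ?thesis .
qed

lemma degree_minus [simp]: "deg (- D) = - deg D"
  using degree_add[of D "- D"] by simp

lemma degree_diff [simp]: "deg (D - E) = deg D - deg E"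
  using degree_add[of D "- E"] by simp

lemma degree_pt [simp]: "deg (pt v m) = m * int (point_degree \<iota> v)"
  using degree_superset[of "{v}" "pt v m"] by (auto simp: lookup_single split: if_splits)

lemma degree_sum: "deg (\<Sum>i\<in>A. D i) = (\<Sum>i\<in>A. deg (D i))"
  by (induction A rule: infinite_finite_induct) auto

lemma degree_effective: "effective D \<Longrightarrow> deg D \<ge> 0"
  unfolding degree_divisor_def effective_def by (intro sum_nonneg) auto

lemma effective_sum: "(\<And>i. i \<in> A \<Longrightarrow> effective (D i)) \<Longrightarrow> effective (\<Sum>i\<in>A. D i)"
proof (induction A rule: infinite_finite_induct)
  case (insert i A)
  then have "effective (D i)" "effective (sum D A)"
    by auto
  then show ?case
    using insert by (simp add: effective_def divisors_add lookup_add)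
qed (auto simp: effective_def divisors_0)

lemma effective_add: "effective D \<Longrightarrow> effective E \<Longrightarrow> effective (D + E)"
  by (simp add: effective_def divisors_add lookup_add)

lemma lookup_sum': "coef (\<Sum>i\<in>A. D i) v = (\<Sum>i\<in>A. coef (D i) v)"
  by (induction A rule: infinite_finite_induct) (auto simp: lookup_add)

lemma ex_divisor:
  assumes "finite {v\<in>points \<iota>. c v \<noteq> 0}"
  shows "\<exists>D\<in>Div. \<forall>v. coef D v = (if v \<in> points \<iota> then c v else 0)"
proof -
  let ?c = "\<lambda>v. if v \<in> points \<iota> then c v else 0"
  have "{v. ?c v \<noteq> 0} = {v\<in>points \<iota>. c v \<noteq> 0}"
    by auto
  then have "coef (Abs_poly_mapping ?c) = ?c"
    using assms by (intro lookup_Abs_poly_mapping) simp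
  then show ?thesis
    by (intro bexI[of _ "Abs_poly_mapping ?c"]) (auto simp: divisors_iff split: if_splits)
qed

lemma ex_positive_part:
  assumes "D \<in> Div"
  shows "\<exists>E. effective E \<and> effective (E - D)"
proof -
  have "{v \<in> points \<iota>. max 0 (coef D v) \<noteq> 0} \<subseteq> Poly_Mapping.keys D"
    by (auto simp: in_keys_iff)
  then have "finite {v\<in>points \<iota>. max 0 (coef D v) \<noteq> 0}"
    by (rule finite_subset) simp
  then obtain E where E: "E \<in> Div" "\<And>v. coef E v = (if v \<in> points \<iota> then max 0 (coef D v) else 0)"
    using ex_divisor[of "\<lambda>v. max 0 (coef D v)"] by blast
  have "coef D v = 0" if "v \<notin> points \<iota>" for v
    using assms that by (auto simp: divisors_iff)
  then show ?thesis
    using E assms by (intro exI[of _ E]) (auto simp: effective_def lookup_minus divisors_diff)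
qed

section \<open>Finiteness and dimension of the spaces \<open>L D\<close>\<close>

lemma L_eq: "L D = {f. \<forall>v\<in>points \<iota>. vge v (- coef D v) f}"
  by (auto simp: L_space_def vge_def)

lemma L_iff: "f \<in> L D \<longleftrightarrow> (\<forall>v\<in>points \<iota>. vge v (- coef D v) f)"
  by (simp add: L_eq)

lemma subspace_L: "subspace (L D)"
  using subspace_semilocal[of "points \<iota>" "\<lambda>v. - coef D v"] by (simp add: L_eq semilocal_def)

lemma L_mono: "effective E \<Longrightarrow> L D \<subseteq> L (D + E)"
  unfolding L_iff effective_def lookup_add subset_iff by (auto intro: vge_mono[of _ "- coef D _"])

lemma L_0: "L 0 = range \<iota>"
proof
  show "L 0 \<subseteq> range \<iota>"
  proof
    fix f assume f: "f \<in> L 0"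
    show "f \<in> range \<iota>"
    proof (rule ccontr)
      assume "f \<notin> range \<iota>"
      then have "transcendental f"
        by (simp add: algebraic_iff_range)
      then obtain v where "v \<in> points \<iota>" "v f < 0"
        using ex_pole by blast
      then show False
        using f transcendental_nonzero[OF \<open>transcendental f\<close>] by (auto simp: L_iff vge_def)
    qed
  qed
qed (auto simp: L_iff vge_iota)

lemma card_range_iota: "card (range \<iota>) = CARD('k)"
proof -
  have "inj \<iota>"
    by (rule injI) (metis iota_diff iota_eq_0_iff right_minus_eq)
  then show ?thesis
    by (rule card_image)
qed

text \<open>Multiplication by a function \<open>t\<close> of order \<open>coef D Q + 1\<close> at
  \<open>Q\<close> carries \<open>L (D + pt Q 1)\<close> into the local ring, and exactly
  \<open>L D\<close> lands in the maximal ideal. The quotient therefore embeds in the residue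
  field.\<close>

lemma L_step_le:
  assumes Q: "Q \<in> points \<iota>" and u: "\<And>i. i < n \<Longrightarrow> u i \<in> L (D + pt Q 1)" "indep n u (L D)"
  shows "n \<le> point_degree \<iota> Q"
proof -
  obtain b where b: "basis (point_degree \<iota> Q) b (local_ring Q) (max_ideal Q)"
    using residue_basis[OF Q] by blast
  obtain t where t: "t \<noteq> 0" "Q t = coef D Q + 1"
    using ex_valuation[OF Q] by blast
  have "indep n (\<lambda>i. t * u i) (max_ideal Q)"
    unfolding indep_def
  proof (intro allI impI)
    fix c i assume *: "comb n (\<lambda>i. t * u i) c \<in> max_ideal Q" "i < n"
    let ?y = "comb n u c"
    have "vge Q (- coef D Q) ?y"
      using * Q t unfolding comb_scale by (simp add: max_ideal_eq vge_mult_iff)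
    moreover have "?y \<in> L (D + pt Q 1)"
      using u by (intro comb_in_subspace subspace_L)
    ultimately have "?y \<in> L D"
      unfolding L_iff by (auto simp: lookup_add lookup_single when_def split: if_splits)
    then show "c i = 0"
      using u * by (auto simp: indep_def)
  qed
  moreover have "t * u i \<in> local_ring Q" if "i < n" for i
    using u(1)[OF that] Q t by (auto simp: L_iff local_ring_eq vge_mult_iff lookup_add lookup_single)
  ultimately show ?thesis
    using indep_le_basis[OF subspace_max_ideal[OF Q] b _ _ subspace_local_ring[OF Q],
        of n "\<lambda>i. t * u i"] by simp
qed

lemma L_step:
  assumes Q: "Q \<in> points \<iota>" and fin: "finite (L D)"
  shows "\<exists>n\<le>point_degree \<iota> Q. finite (L (D + pt Q 1)) \<and> card (L (D + pt Q 1)) = CARD('k) ^ n * card (L D)"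
proof -
  have "\<exists>n u. n \<le> point_degree \<iota> Q \<and> basis n u (L (D + pt Q 1)) (L D)"
    by (rule basis_exists[OF subspace_L]) (rule L_step_le[OF Q])
  then obtain n u where n: "n \<le> point_degree \<iota> Q" "basis n u (L (D + pt Q 1)) (L D)"
    by blast
  have "L D \<subseteq> L (D + pt Q 1)"
    using Q by (intro L_mono) (auto simp: effective_def divisors_pt lookup_single when_def)
  then show ?thesis
    using basis_card[OF subspace_L subspace_L _ fin n(2)] n(1) by blast
qed

lemma L_effective:
  assumes "effective E" "finite (L D)"
  shows "\<exists>n. int n \<le> deg E \<and> finite (L (D + E)) \<and> card (L (D + E)) = CARD('k) ^ n * card (L D)"
  using assms(1)
proof (induction "nat (deg E)" arbitrary: E rule: less_induct)
  case less
  show ?case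
  proof (cases "E = 0")
    case True
    then show ?thesis
      using assms by (intro exI[of _ 0]) auto
  next
    case False
    then obtain Q where Q: "coef E Q \<noteq> 0"
      by (metis poly_mapping_eqI lookup_zero)
    then have Qp: "Q \<in> points \<iota>"
      using less.prems by (auto simp: effective_def divisors_iff)
    define E' where "E' = E - pt Q 1"
    have "coef E Q \<ge> 0"
      using less.prems by (simp add: effective_def)
    then have "coef E Q \<ge> 1"
      using Q by linarith
    then have E': "effective E'"
      using less.prems Q Qp divisors_diff[OF _ divisors_pt]
      by (auto simp: effective_def E'_def lookup_minus lookup_single when_def)
    have degE: "deg E = deg E' + int (point_degree \<iota> Q)"
      by (simp add: E'_def)
    then have "nat (deg E') < nat (deg E)"
      using degree_effective[OF E'] point_degree_pos[OF Qp] by linarith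
    then obtain n where n: "int n \<le> deg E'" "finite (L (D + E'))"
        "card (L (D + E')) = CARD('k) ^ n * card (L D)"
      using less.hyps E' by blast
    have eq: "D + E' + pt Q 1 = D + E"
      by (simp add: E'_def)
    obtain m where "m \<le> point_degree \<iota> Q" "finite (L (D + E))"
        "card (L (D + E)) = CARD('k) ^ m * card (L (D + E'))"
      using L_step[OF Qp n(2)] unfolding eq by blast
    then show ?thesis
      using n degE by (intro exI[of _ "m + n"]) (auto simp: power_add)
  qed
qed

lemma finite_L:
  assumes "D \<in> Div"
  shows "finite (L D)"
proof -
  obtain E where E: "effective E" "effective (E - D)"
    using ex_positive_part[OF assms] by blast
  have "finite (L 0)"
    by (simp add: L_0)
  then have "finite (L E)"
    using L_effective[OF E(1), of 0] by auto
  moreover have "L D \<subseteq> L E"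
    using L_mono[OF E(2), of D] by simp
  ultimately show ?thesis
    using finite_subset by blast
qed

text \<open>An independent family of size \<open>n\<close> gives \<open>q ^ n > n\<close> elements
  of \<open>W\<close>, so \<open>card W\<close> is a crude but sufficient bound for
  \<open>basis_exists\<close>, applied modulo \<open>{0}\<close>.\<close>

lemma card_finite_subspace:
  assumes W: "subspace W" "finite W"
  shows "\<exists>l. card W = CARD('k) ^ l"
proof -
  have zero: "subspace {0}"
    by (simp add: subspace_def)
  have bound: "n \<le> card W" if u: "\<And>i. i < n \<Longrightarrow> u i \<in> W" "indep n u {0}" for n u
  proof -
    have "inj_on (comb n u) ({..<n} \<rightarrow>\<^sub>E UNIV)"
    proof (rule inj_onI)
      fix c d assume cd: "c \<in> {..<n} \<rightarrow>\<^sub>E (UNIV :: 'k set)" "d \<in> {..<n} \<rightarrow>\<^sub>E (UNIV :: 'k set)"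
        "comb n u c = comb n u d"
      then have "\<forall>i<n. c i = d i"
        using indep_inj[OF zero u(2), of c d] by simp
      then show "c = d"
        using cd(1,2) by (intro PiE_ext[of c "{..<n}" "\<lambda>_. UNIV"]) auto
    qed
    then have "card ({..<n} \<rightarrow>\<^sub>E (UNIV :: 'k set)) \<le> card W"
      using W u(1) by (intro card_inj_on_le[of "comb n u"]) (auto intro: comb_in_subspace)
    then have "CARD('k) ^ n \<le> card W"
      by (simp add: card_PiE)
    then show ?thesis
      using power_gt_expt[of "CARD('k)" n] q_gt_1 by simp
  qed
  have "\<exists>n u. n \<le> card W \<and> basis n u W {0}"
    by (rule basis_exists[OF zero]) (rule bound)
  then obtain n u where B: "basis n u W {0}"
    by blast
  have "card W = CARD('k) ^ n * card {0::'a}"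
    using basis_card(2)[OF W(1) zero _ _ B] subspace_0[OF W(1)] by simp
  then show ?thesis
    by auto
qed

text \<open>The dimension over \<open>k\<close>, recovered as a logarithm of the cardinality; for
  \<open>D\<close> in \<open>Div\<close> the exponent exists by
  \<open>card_finite_subspace\<close>.\<close>

definition ell :: "'a divisor \<Rightarrow> nat" where
  "ell D = (THE l. card (L D) = CARD('k) ^ l)"

lemma card_L: "D \<in> Div \<Longrightarrow> card (L D) = CARD('k) ^ ell D"
proof -
  assume "D \<in> Div"
  then obtain l where l: "card (L D) = CARD('k) ^ l"
    using card_finite_subspace[OF subspace_L finite_L] by blast
  then have "ell D = l"
    unfolding ell_def by (auto intro!: the_equality)
  then show ?thesis
    using l by simp
qed

lemma ell_add_le:
  assumes "D \<in> Div" "effective E"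
  shows "int (ell (D + E)) \<le> int (ell D) + deg E"
proof -
  have D: "D + E \<in> Div"
    using assms by (simp add: effective_def divisors_add)
  obtain n where "int n \<le> deg E" "card (L (D + E)) = CARD('k) ^ n * card (L D)"
    using L_effective[OF assms(2) finite_L[OF assms(1)]] by blast
  moreover from this have "CARD('k) ^ ell (D + E) = CARD('k) ^ (n + ell D)"
    using card_L[OF assms(1)] card_L[OF D] by (simp add: power_add)
  then have "ell (D + E) = n + ell D"
    by (simp only: q_power_eq_iff)
  ultimately show ?thesis
    by simp
qed

lemma ell_0: "ell 0 = 1"
proof -
  have "CARD('k) ^ ell 0 = CARD('k) ^ 1"
    using card_L[OF divisors_0] by (simp add: L_0 card_range_iota)
  then show ?thesis
    by (simp only: q_power_eq_iff)
qed

lemma ell_effective_le: "effective D \<Longrightarrow> int (ell D) \<le> 1 + deg D"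
  using ell_add_le[OF divisors_0, of D] by (simp add: ell_0)

lemma ell_pos:
  assumes "D \<in> Div" "ell D > 0"
  shows "\<exists>f. f \<noteq> 0 \<and> f \<in> L D"
proof (rule ccontr)
  assume "\<not> ?thesis"
  then have "L D = {0}"
    using subspace_0[OF subspace_L] by auto
  then have "CARD('k) ^ ell D = CARD('k) ^ 0"
    using card_L[OF assms(1)] by simp
  then show False
    using assms(2) by (simp only: q_power_eq_iff)
qed


section \<open>Principal divisors have degree zero\<close>

text \<open>The pole divisor of \<open>x\<close>; the divisor of zeros is written
  \<open>poles (inverse x)\<close>.\<close>

definition poles :: "'a \<Rightarrow> 'a divisor" where
  "poles x = (SOME D. D \<in> Div \<and> (\<forall>v. coef D v = (if v \<in> points \<iota> then max 0 (- v x) else 0)))"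

lemma poles:
  assumes "x \<noteq> 0"
  shows "poles x \<in> Div" "coef (poles x) v = (if v \<in> points \<iota> then max 0 (- v x) else 0)"
proof -
  have "finite {v\<in>points \<iota>. max 0 (- v x) \<noteq> 0}"
    by (rule finite_subset[OF _ finite_support[OF assms]]) auto
  then have "\<exists>D. D \<in> Div \<and> (\<forall>v. coef D v = (if v \<in> points \<iota> then max 0 (- v x) else 0))"
    using ex_divisor[of "\<lambda>v. max 0 (- v x)"] by blast
  from someI_ex[OF this] show "poles x \<in> Div"
    "coef (poles x) v = (if v \<in> points \<iota> then max 0 (- v x) else 0)"
    unfolding poles_def by blast+
qed

lemma effective_poles: "x \<noteq> 0 \<Longrightarrow> effective (poles x)"
  using poles by (simp add: effective_def)

lemma zeros_le_rank:
  assumes x: "transcendental x"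
  shows "deg (poles (inverse x)) \<le> int (rank x)"
proof -
  have x0: "x \<noteq> 0"
    using transcendental_nonzero[OF x] .
  let ?V = "Poly_Mapping.keys (poles (inverse x))"
  have V: "v \<in> points \<iota> \<and> v x > 0 \<and> coef (poles (inverse x)) v = int (nat (v x))" if "v \<in> ?V" for v
    using that x0 poles(2)[of "inverse x" v] by (auto simp: in_keys_iff v_inverse split: if_splits)
  then have "deg (poles (inverse x)) = int (\<Sum>v\<in>?V. nat (v x) * point_degree \<iota> v)"
    unfolding degree_divisor_def of_nat_sum by (intro sum.cong) auto
  also have "\<dots> \<le> int (rank x)"
    using V by (intro of_nat_mono zeros_degree_le_rank[OF x]) auto
  finally show ?thesis .
qed

lemma vge_power: "v \<in> points \<iota> \<Longrightarrow> x \<noteq> 0 \<Longrightarrow> vge v (int n * v x) (x ^ n)"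
  by (simp add: vge_def v_power)

text \<open>The divisor \<open>C\<close> absorbs the poles of a largest free family and does not
  depend on \<open>m\<close>; the polynomial coefficients have poles at most \<open>m\<close> times
  those of \<open>x\<close>. Freeness makes the combinations distinct, and the \<open>m + 1\<close>
  coefficients per polynomial give the factor \<open>Suc m\<close>.\<close>

lemma ell_multiple_poles_ge:
  assumes x: "transcendental x"
  shows "\<exists>C. effective C \<and> (\<forall>m. Suc m * rank x \<le> ell ((\<Sum>j<m. poles x) + C))"
proof -
  have x0: "x \<noteq> 0"
    using transcendental_nonzero[OF x] .
  obtain u where u: "free x (rank x) u"
    using ex_free_rank[OF x] by blast
  define C where "C = (\<Sum>i<rank x. poles (u i))"
  have u0: "u i \<noteq> 0" if "i < rank x" for i
    using free_nonzero[OF u that] .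
  have C: "effective C"
    unfolding C_def by (intro effective_sum effective_poles u0) auto
  have "Suc m * rank x \<le> ell ((\<Sum>j<m. poles x) + C)" for m
  proof -
    define D where "D = (\<Sum>j<m. poles x) + C"
    have D: "D \<in> Div"
      using effective_add[OF effective_sum C, of "{..<m}" "\<lambda>_. poles x"] effective_poles[OF x0]
      unfolding D_def effective_def by blast
    let ?A = "{..<rank x} \<rightarrow>\<^sub>E {p::'k poly. degree p \<le> m}"
    let ?f = "\<lambda>p. \<Sum>i<rank x. ev (p i) x * u i"
    have "?f p \<in> L D" if p: "p \<in> ?A" for p
    proof (intro subspace_sum subspace_L)
      fix i assume i: "i \<in> {..<rank x}"
      show "ev (p i) x * u i \<in> L D"
        unfolding L_iff
      proof
        fix v assume v: "v \<in> points \<iota>"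
        have "vge v (- int m * max 0 (- v x)) (ev (p i) x)"
        proof -
          have "degree (p i) \<le> m"
            using p i by auto
          then have "ev (p i) x = (\<Sum>j\<le>m. \<iota> (coeff (p i) j) * x ^ j)"
            by (rule ev_altdef)
          also have "\<dots> \<in> {y. vge v (- int m * max 0 (- v x)) y}"
          proof (intro subspace_sum subspace_scale subspace_vge v CollectI)
            fix j assume "j \<in> {..m}"
            then have "int j * max 0 (- v x) \<le> int m * max 0 (- v x)"
              by (intro mult_right_mono) auto
            moreover have "int j * (- v x) \<le> int j * max 0 (- v x)"
              by (intro mult_left_mono) auto
            ultimately have "- int m * max 0 (- v x) \<le> int j * v x"
              by simp
            then show "vge v (- int m * max 0 (- v x)) (x ^ j)"
              using vge_power[OF v x0, of j] vge_mono by blast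
          qed
          finally show ?thesis
            by simp
        qed
        moreover have "vge v (- coef C v) (u i)"
        proof -
          have "coef (poles (u i)) v \<le> coef C v"
            unfolding C_def lookup_sum' using i u0 effective_poles
            by (intro member_le_sum) (auto simp: effective_def)
          then show ?thesis
            using v poles(2)[OF u0, of i v] i by (auto simp: vge_def)
        qed
        ultimately have "vge v (- int m * max 0 (- v x) + - coef C v) (ev (p i) x * u i)"
          by (rule vge_mult[OF v])
        then show "vge v (- coef D v) (ev (p i) x * u i)"
          using v poles(2)[OF x0, of v] by (simp add: D_def lookup_add lookup_sum')
      qed
    qed
    then have "card ?A \<le> card (L D)"
      using free_inj_on[OF u] finite_L[OF D] by (intro card_inj_on_le[of ?f]) auto
    then have "CARD('k) ^ (Suc m * rank x) \<le> CARD('k) ^ ell D"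
      using card_poly_families(2)[of "{..<rank x}" m] card_L[OF D] by simp
    then show ?thesis
      unfolding D_def by (simp only: q_power_le_iff)
  qed
  then show ?thesis
    using C by blast
qed

lemma rank_le_poles:
  assumes x: "transcendental x"
  shows "int (rank x) \<le> deg (poles x)"
proof (rule ccontr)
  assume less: "\<not> ?thesis"
  have eff: "effective (poles x)"
    using effective_poles transcendental_nonzero[OF x] by blast
  let ?d = "deg (poles x)"
  have d: "?d \<ge> 0"
    using degree_effective[OF eff] .
  obtain C where C: "effective C" "\<And>m. Suc m * rank x \<le> ell ((\<Sum>j<m. poles x) + C)"
    using ell_multiple_poles_ge[OF x] by blast
  \<comment> \<open>Writing \<open>d\<close> for the degree of the poles,
    \<open>(m + 1) (d + 1) \<le> 1 + m d + deg C\<close> amounts to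
    \<open>m + d \<le> deg C\<close>, which this choice of \<open>m\<close> violates.\<close>
  define m where "m = nat (deg C) + 1"
  have "int (Suc m) * (?d + 1) \<le> int (Suc m) * int (rank x)"
    using less by (intro mult_left_mono) auto
  also have "\<dots> \<le> int (ell ((\<Sum>j<m. poles x) + C))"
    using C(2)[of m] by (metis of_nat_le_iff of_nat_mult)
  also have "\<dots> \<le> 1 + deg ((\<Sum>j<m. poles x) + C)"
    using eff C by (intro ell_effective_le effective_add effective_sum)
  also have "\<dots> = 1 + int m * ?d + deg C"
    by (simp add: degree_sum)
  finally show False
    using d degree_effective[OF C(1)] by (simp add: algebra_simps m_def)
qed

text \<open>Passing to \<open>1 / x\<close> exchanges zeros and poles, so the two rank inequalities
  for \<open>x\<close> and those for \<open>1 / x\<close> form a closed chain and are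
  equalities.\<close>

lemma degree_poles:
  assumes x: "transcendental x"
  shows "deg (poles x) = int (rank x)" "deg (poles (inverse x)) = int (rank x)"
  using zeros_le_rank[OF x] rank_le_poles[OF x] zeros_le_rank[OF transcendental_inverse[OF x]]
    rank_le_poles[OF transcendental_inverse[OF x]] by auto

lemma degree_principal:
  assumes D: "D \<in> Div" and f: "f \<noteq> 0" "\<And>v. v \<in> points \<iota> \<Longrightarrow> coef D v = v f"
  shows "deg D = 0"
proof (cases "transcendental f")
  case True
  have "D = poles (inverse f) - poles f"
  proof (rule poly_mapping_eqI)
    fix v
    show "coef D v = coef (poles (inverse f) - poles f) v"
      using D f poles(2)[of f v] poles(2)[of "inverse f" v]
      by (cases "v \<in> points \<iota>") (auto simp: lookup_minus v_inverse divisors_iff)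
  qed
  then show ?thesis
    using degree_poles[OF True] by simp
next
  case False
  then have "coef D v = 0" for v
    using D f(2) v_nonzero_transcendental[of v f] unfolding divisors_iff by metis
  then have "D = 0"
    by (intro poly_mapping_eqI) simp
  then show ?thesis
    by simp
qed

lemma ex_principal:
  assumes "f \<noteq> 0"
  shows "\<exists>D\<in>Div. (\<forall>v\<in>points \<iota>. coef D v = v f) \<and> deg D = 0"
proof -
  obtain D where "D \<in> Div" "\<forall>v. coef D v = (if v \<in> points \<iota> then v f else 0)"
    using ex_divisor[OF finite_support[OF assms]] by blast
  then show ?thesis
    using degree_principal[OF _ assms, of D] by (intro bexI[of _ D]) auto
qed


section \<open>Riemann's theorem\<close>

text \<open>Riemann's inequality says that this is bounded above; its maximum is
  \<open>g - 1\<close>.\<close>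

definition excess :: "'a divisor \<Rightarrow> int" where
  "excess D = deg D - int (ell D)"

lemma excess_mono: "D \<in> Div \<Longrightarrow> effective E \<Longrightarrow> excess D \<le> excess (D + E)"
  using ell_add_le[of D E] by (simp add: excess_def)

lemma excess_mono': "D \<in> Div \<Longrightarrow> effective (E - D) \<Longrightarrow> excess D \<le> excess E"
  using excess_mono[of D "E - D"] by simp

lemma ell_linear_equivalent:
  assumes D: "D \<in> Div" "E \<in> Div" and f: "f \<noteq> 0" "\<And>v. v \<in> points \<iota> \<Longrightarrow> coef E v = coef D v + v f"
  shows "ell E = ell D"
proof -
  have "L D = (*) f ` L E"
  proof (intro equalityI subsetI)
    fix x assume "x \<in> (*) f ` L E"
    then show "x \<in> L D"
      using f by (auto simp: L_iff vge_mult_iff)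
  next
    fix x assume x: "x \<in> L D"
    have "vge v (- coef E v) (x / f)" if v: "v \<in> points \<iota>" for v
    proof -
      have "vge v (- coef D v) (f * (x / f))"
        using x f v by (simp add: L_iff)
      then show ?thesis
        unfolding vge_mult_iff[OF v f(1)] by (simp add: f(2)[OF v])
    qed
    then have "x / f \<in> L E"
      by (simp add: L_iff)
    then show "x \<in> (*) f ` L E"
      using f by (intro image_eqI[of _ _ "x / f"]) auto
  qed
  moreover have "inj_on ((*) f) (L E)"
    using f by (auto simp: inj_on_def)
  ultimately have "card (L D) = card (L E)"
    by (simp add: card_image)
  then show ?thesis
    using card_L D by simp
qed

lemma effective_translate:
  assumes D: "D \<in> Div" "F \<in> Div" and F: "\<forall>v\<in>points \<iota>. coef F v = v f" and f: "f \<noteq> 0" "f \<in> L D"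
  shows "effective (D + F)"
proof -
  have DF: "D + F \<in> Div"
    using D by (rule divisors_add)
  have "coef (D + F) v \<ge> 0" for v
  proof (cases "v \<in> points \<iota>")
    case True
    then have "- coef D v \<le> v f"
      using f by (simp add: L_iff vge_def)
    then show ?thesis
      using F True by (simp add: lookup_add)
  next
    case False
    then have "coef (D + F) v = 0"
      using DF divisors_iff by blast
    then show ?thesis
      by simp
  qed
  then show ?thesis
    using DF by (simp add: effective_def)
qed

text \<open>The divisor of \<open>f\<close> moves \<open>E\<close> within its class to a divisor
  dominating \<open>D\<close>; the excess depends only on the class and is monotone.\<close>

lemma excess_translate:
  assumes D: "D \<in> Div" "E \<in> Div" and f: "f \<noteq> 0" "f \<in> L (E - D)"
  shows "excess D \<le> excess E"
proof -
  obtain F where F: "F \<in> Div" "\<forall>v\<in>points \<iota>. coef F v = v f" "deg F = 0"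
    using ex_principal[OF f(1)] by blast
  have FE: "E + F \<in> Div"
    using D F divisors_add by blast
  have "ell (E + F) = ell E"
    using D FE f F by (intro ell_linear_equivalent[of _ _ f]) (auto simp: lookup_add)
  then have "excess (E + F) = excess E"
    using F by (simp add: excess_def)
  moreover have "effective (E - D + F)"
    using D F f by (intro effective_translate divisors_diff) auto
  then have "effective (E + F - D)"
    by (simp add: algebra_simps)
  ultimately show ?thesis
    using excess_mono'[OF D(1)] by metis
qed

text \<open>Multiples of the pole divisor of a transcendental \<open>x\<close> have bounded excess,
  and every divisor is dominated, up to linear equivalence, by such a multiple.\<close>

lemma excess_bounded: "\<exists>c. \<forall>D\<in>Div. excess D \<le> c"
proof -
  obtain x where x: "transcendental x"
    using ex_generators by blast
  let ?X = "\<lambda>m. \<Sum>j<m. poles x" and ?n = "rank x"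
  have effX: "effective (?X m)" for m
    using effective_poles transcendental_nonzero[OF x] by (intro effective_sum) blast
  have X: "?X m \<in> Div" for m
    using effX[of m] by (simp add: effective_def)
  have degX: "deg (?X m) = int m * int ?n" for m
    by (simp add: degree_sum degree_poles[OF x])
  have "free x 1 (\<lambda>_. 1)"
    using x by (auto simp: free_def)
  then have n: "?n \<ge> 1"
    by (rule free_le_rank[OF x])
  obtain C where C: "effective C" "\<And>m. Suc m * ?n \<le> ell (?X m + C)"
    using ell_multiple_poles_ge[OF x] by blast
  have ellX: "int (ell (?X m)) \<ge> int (Suc m) * int ?n - deg C" for m
  proof -
    have "int (Suc m) * int ?n \<le> int (ell (?X m + C))"
      using C(2)[of m] by (metis of_nat_le_iff of_nat_mult)
    then show ?thesis
      using ell_add_le[OF X[of m] C(1)] by linarith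
  qed
  have "excess D \<le> deg C" if D: "D \<in> Div" for D
  proof -
    obtain E where E: "effective E" "effective (E - D)"
      using ex_positive_part[OF D] by blast
    have ED: "E \<in> Div"
      using E by (simp add: effective_def)
    \<comment> \<open>With \<open>rank x \<ge> 1\<close> this makes
      \<open>(m + 1) rank x - deg C - deg E\<close> at least 1, so \<open>L (?X m - E)\<close>
      contains a nonzero function.\<close>
    define m where "m = nat (deg C + deg E)"
    have "int (ell (?X m)) \<le> int (ell (?X m - E)) + deg E"
      using ell_add_le[OF divisors_diff[OF X ED] E(1), of m] by simp
    moreover define k where "k = int (Suc m) * int ?n"
    have "int (Suc m) * 1 \<le> k"
      unfolding k_def using n by (intro mult_left_mono) auto
    moreover have "int (Suc m) = deg C + deg E + 1"
      using degree_effective[OF C(1)] degree_effective[OF E(1)] by (simp add: m_def)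
    moreover have "k - deg C \<le> int (ell (?X m))"
      using ellX[of m] by (simp only: k_def)
    moreover have "0 < l'" if "l \<le> l' + e" "s * 1 \<le> k" "s = c + e + 1" "k - c \<le> l" for l l' e s c k :: int
      using that by simp
    ultimately have "int (ell (?X m - E)) > 0"
      by blast
    then have "ell (?X m - E) > 0"
      by (simp only: of_nat_0_less_iff)
    then obtain f where "f \<noteq> 0" "f \<in> L (?X m - E)"
      using ell_pos[OF divisors_diff[OF X ED]] by blast
    then have "excess E \<le> excess (?X m)"
      using excess_translate[OF ED X] by blast
    also have "\<dots> \<le> deg C"
      using ellX[of m] by (simp add: excess_def degX algebra_simps)
    finally show ?thesis
      using excess_mono'[OF D E(2)] by simp
  qed
  then show ?thesis
    by blast
qed

lemma ex_excess_max: "\<exists>A\<in>Div. \<forall>D\<in>Div. excess D \<le> excess A"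
proof -
  obtain c where c: "\<forall>D\<in>Div. excess D \<le> c"
    using excess_bounded by blast
  obtain A where A: "A \<in> Div" "\<forall>D. D \<in> Div \<longrightarrow> nat (c - excess A) \<le> nat (c - excess D)"
    using ex_has_least_nat[of "\<lambda>D. D \<in> Div" 0 "\<lambda>D. nat (c - excess D)"] divisors_0 by blast
  have "excess D \<le> excess A" if "D \<in> Div" for D
    using A(2) that c A(1) by (smt (verit) nat_le_eq_zle)
  then show ?thesis
    using A by blast
qed

lemma L_negative_degree:
  assumes D: "D \<in> Div" "deg D < 0"
  shows "L D = {0}"
proof (rule ccontr)
  assume "L D \<noteq> {0}"
  then obtain f where f: "f \<noteq> 0" "f \<in> L D"
    using subspace_0[OF subspace_L] by blast
  obtain F where F: "F \<in> Div" "\<forall>v\<in>points \<iota>. coef F v = v f" "deg F = 0"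
    using ex_principal[OF f(1)] by blast
  have "effective (D + F)"
    using D F f by (intro effective_translate) auto
  then show False
    using degree_effective[of "D + F"] F D by simp
qed


section \<open>Counting gaps along a rational point\<close>

definition nongap :: "'a point \<Rightarrow> 'a divisor \<Rightarrow> bool" where
  "nongap P A \<longleftrightarrow> L A \<noteq> L (A - pt P 1)"

definition nongaps :: "'a point \<Rightarrow> 'a divisor \<Rightarrow> int set" where
  "nongaps P D = {i. nongap P (D + pt P i)}"

text \<open>Lowering the bound at \<open>P\<close> by one loses exactly the functions that attain it
  there. Attaining a bound is preserved by products, which is why \<open>nongap\<close> is
  additive.\<close>

lemma nongap_iff:
  assumes P: "P \<in> points \<iota>"
  shows "nongap P A \<longleftrightarrow> (\<exists>f. f \<noteq> 0 \<and> f \<in> L A \<and> P f = - coef A P)"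
proof -
  have "L (A - pt P 1) \<subseteq> L A"
    using L_mono[of "pt P 1" "A - pt P 1"] P
    by (auto simp: effective_def divisors_pt lookup_single when_def)
  then have "nongap P A \<longleftrightarrow> (\<exists>f\<in>L A. f \<notin> L (A - pt P 1))"
    by (auto simp: nongap_def)
  also have "f \<notin> L (A - pt P 1) \<longleftrightarrow> f \<noteq> 0 \<and> P f = - coef A P" if f: "f \<in> L A" for f
  proof
    assume "f \<notin> L (A - pt P 1)"
    then obtain v where "v \<in> points \<iota>" "\<not> vge v (- coef (A - pt P 1) v) f"
      by (auto simp: L_iff)
    then show "f \<noteq> 0 \<and> P f = - coef A P"
      using f by (auto simp: L_iff vge_def lookup_minus lookup_single when_def split: if_splits)
  next
    assume "f \<noteq> 0 \<and> P f = - coef A P"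
    then show "f \<notin> L (A - pt P 1)"
      using P by (auto simp: L_iff vge_def lookup_minus intro!: bexI[of _ P])
  qed
  ultimately show ?thesis
    by blast
qed

lemma nongap_add:
  assumes P: "P \<in> points \<iota>" and "nongap P A" "nongap P B"
  shows "nongap P (A + B)"
proof -
  obtain f g where f: "f \<noteq> 0" "f \<in> L A" "P f = - coef A P" and g: "g \<noteq> 0" "g \<in> L B" "P g = - coef B P"
    using assms nongap_iff by blast
  have "f * g \<in> L (A + B)"
    unfolding L_iff
  proof
    fix v assume v: "v \<in> points \<iota>"
    then have "vge v (- coef A v + - coef B v) (f * g)"
      using f g by (intro vge_mult) (auto simp: L_iff)
    then show "vge v (- coef (A + B) v) (f * g)"
      by (simp add: lookup_add)
  qed
  then show ?thesis
    using f g P unfolding nongap_iff[OF P]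
    by (intro exI[of _ "f * g"]) (auto simp: v_mult lookup_add)
qed

lemma nongap_linear_equivalent:
  assumes P: "P \<in> points \<iota>" and A: "nongap P A"
    and g: "g \<noteq> 0" "\<And>v. v \<in> points \<iota> \<Longrightarrow> coef B v = coef A v + v g"
  shows "nongap P B"
proof -
  obtain f where f: "f \<noteq> 0" "f \<in> L A" "P f = - coef A P"
    using A nongap_iff[OF P] by blast
  have "f / g \<in> L B"
    using f g by (auto simp: L_iff vge_def v_divide)
  then show ?thesis
    using f g P unfolding nongap_iff[OF P] by (intro exI[of _ "f / g"]) (auto simp: v_divide)
qed

end

locale pointed_function_field = function_field \<iota>
  for \<iota> :: "'k::{field,finite} \<Rightarrow> 'a::field" +
  fixes P :: "'a point"
  assumes rational: "P \<in> rational_points \<iota>"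
begin

lemma P_point [simp]: "P \<in> points \<iota>"
  and P_degree [simp]: "point_degree \<iota> P = 1"
  using rational by (auto simp: rational_points_def)

lemma divisors_pt_P: "D \<in> Div \<Longrightarrow> D + pt P i \<in> Div"
  by (simp add: divisors_add divisors_pt)

lemma effective_pt_P: "i \<ge> 0 \<Longrightarrow> effective (pt P i)"
  by (auto simp: effective_def divisors_pt lookup_single when_def)

text \<open>Rationality of \<open>P\<close> enters here: passing from \<open>A - P\<close> to
  \<open>A\<close> raises the dimension by at most 1, hence by exactly 1 when the spaces
  differ.\<close>

lemma ell_nongap:
  assumes A: "A \<in> Div"
  shows "ell A = ell (A - pt P 1) + (if nongap P A then 1 else 0)"
proof -
  have A': "A - pt P 1 \<in> Div"
    using A by (simp add: divisors_diff divisors_pt)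
  have le: "ell A \<le> ell (A - pt P 1) + 1"
    using ell_add_le[OF A' effective_pt_P[of 1]] by simp
  have sub: "L (A - pt P 1) \<subseteq> L A"
    using L_mono[OF effective_pt_P[of 1], of "A - pt P 1"] by simp
  show ?thesis
  proof (cases "nongap P A")
    case True
    then have "L (A - pt P 1) \<subset> L A"
      using sub by (auto simp: nongap_def)
    then have "card (L (A - pt P 1)) < card (L A)"
      using finite_L[OF A] psubset_card_mono by blast
    then have "\<not> ell A \<le> ell (A - pt P 1)"
      using card_L[OF A] card_L[OF A'] q_power_le_iff[of "ell A" "ell (A - pt P 1)"] by linarith
    then show ?thesis
      using le True by simp
  next
    case False
    then have "card (L (A - pt P 1)) = card (L A)"
      by (simp add: nongap_def)
    then show ?thesis
      using card_L[OF A] card_L[OF A'] False by simp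
  qed
qed

lemma card_nongaps:
  assumes D: "D \<in> Div" and "a \<le> b"
  shows "ell (D + pt P b) = ell (D + pt P a) + card (nongaps P D \<inter> {a<..b})"
  using assms(2)
proof (induction b rule: int_ge_induct)
  case (step b)
  have eq: "D + pt P (b + 1) - pt P 1 = D + pt P b"
    by (simp add: single_add)
  have "{a<..b + 1} = insert (b + 1) {a<..b}"
    using step by auto
  then have "nongaps P D \<inter> {a<..b + 1} =
      (if nongap P (D + pt P (b + 1)) then insert (b + 1) (nongaps P D \<inter> {a<..b})
       else nongaps P D \<inter> {a<..b})"
    by (auto simp: nongaps_def)
  then have "card (nongaps P D \<inter> {a<..b + 1}) =
      card (nongaps P D \<inter> {a<..b}) + (if nongap P (D + pt P (b + 1)) then 1 else 0)"
    by simp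
  then show ?case
    using step ell_nongap[OF divisors_pt_P[OF D, of "b + 1"]] unfolding eq by simp
qed simp

text \<open>The constant is the maximal excess \<open>g - 1\<close>, chosen before \<open>D\<close>,
  so it cancels in comparisons. The thresholds may be moved outward, which allows a common window
  for two divisors.\<close>

lemma nongaps_asymptotic:
  "\<exists>\<gamma>. \<forall>D\<in>Div. \<exists>a0 b0. \<forall>a\<le>a0. \<forall>b\<ge>b0. nongaps P D \<subseteq> {a<..} \<and> {b<..} \<subseteq> nongaps P D \<and>
     int (card (nongaps P D \<inter> {a<..b})) = deg D + b - \<gamma>"
proof -
  obtain A where A: "A \<in> Div" and max: "\<And>D. D \<in> Div \<Longrightarrow> excess D \<le> excess A"
    using ex_excess_max by blast
  have "\<exists>a0 b0. \<forall>a\<le>a0. \<forall>b\<ge>b0. nongaps P D \<subseteq> {a<..} \<and> {b<..} \<subseteq> nongaps P D \<and>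
     int (card (nongaps P D \<inter> {a<..b})) = deg D + b - excess A" if D: "D \<in> Div" for D
  proof -
    \<comment> \<open>For \<open>i \<le> a0\<close> the degree of \<open>D + iP\<close> is negative,
      so the dimension is 0.\<close>
    define a0 where "a0 = - deg D - 1"
    \<comment> \<open>From \<open>b0\<close> on, maximality of \<open>excess A\<close> forces
      \<open>L (D + pt P i - A)\<close> to be nonzero, whence \<open>D + iP\<close> has the maximal
      excess too. The \<open>max\<close> with \<open>a0\<close> keeps the ends of the window in
      order.\<close>
    define b0 where "b0 = max a0 (deg A + excess A - deg D + 1)"
    have low: "L (D + pt P i) = {0}" if "i \<le> a0" for i
      using that by (intro L_negative_degree divisors_pt_P D) (auto simp: a0_def)
    then have ell_low: "ell (D + pt P i) = 0" if "i \<le> a0" for i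
    proof -
      have "CARD('k) ^ ell (D + pt P i) = CARD('k) ^ 0"
        using low[OF that] card_L[OF divisors_pt_P[OF D, of i]] by simp
      then show ?thesis
        by (simp only: q_power_eq_iff)
    qed
    have high: "excess (D + pt P i) = excess A" if i: "i \<ge> b0" for i
    proof -
      have Di: "D + pt P i \<in> Div" "D + pt P i - A \<in> Div"
        using D A by (auto simp: divisors_pt_P divisors_diff)
      have "deg D + i - deg A - int (ell (D + pt P i - A)) \<le> excess A"
        using max[OF Di(2)] by (simp add: excess_def)
      then have "ell (D + pt P i - A) > 0"
        using i by (simp add: b0_def)
      then have "excess A \<le> excess (D + pt P i)"
        using ell_pos[OF Di(2)] excess_translate[OF A Di(1)] by blast
      then show ?thesis
        using max[OF Di(1)] by simp
    qed
    have eq: "D + pt P i - pt P 1 = D + pt P (i - 1)" for i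
      by (simp add: single_diff)
    have "nongaps P D \<subseteq> {a<..} \<and> {b<..} \<subseteq> nongaps P D \<and>
       int (card (nongaps P D \<inter> {a<..b})) = deg D + b - excess A" if ab: "a \<le> a0" "b \<ge> b0" for a b
    proof (intro conjI subsetI)
      fix i assume i: "i \<in> nongaps P D"
      show "i \<in> {a<..}"
      proof (rule ccontr)
        assume "i \<notin> {a<..}"
        then have "L (D + pt P i) = L (D + pt P (i - 1))"
          using low ab by simp
        then show False
          using i by (simp add: nongaps_def nongap_def eq)
      qed
    next
      fix i assume "i \<in> {b<..}"
      then have "excess (D + pt P i) = excess A" "excess (D + pt P (i - 1)) = excess A"
        using high ab by auto
      then have "int (ell (D + pt P i)) = int (ell (D + pt P (i - 1))) + 1"
        by (simp add: excess_def)
      then show "i \<in> nongaps P D"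
        using ell_nongap[OF divisors_pt_P[OF D, of i]] unfolding eq
        by (auto simp: nongaps_def split: if_splits)
    next
      have "a \<le> b"
        using ab by (simp add: b0_def)
      then have "int (card (nongaps P D \<inter> {a<..b})) = int (ell (D + pt P b))"
        using card_nongaps[OF D] ell_low ab by simp
      also have "\<dots> = deg D + b - excess A"
        using high[OF ab(2)] by (simp add: excess_def)
      finally show "int (card (nongaps P D \<inter> {a<..b})) = deg D + b - excess A" .
    qed
    then show ?thesis
      by blast
  qed
  then show ?thesis
    by blast
qed

text \<open>Both sets lie above \<open>a\<close> and contain everything above \<open>b\<close>, so
  they differ only in a finite window; there the intersection, \<open>b\<close> and the constant
  cancel from the two counts.\<close>

lemma card_nongaps_diff:
  assumes D: "D \<in> Div" and E: "E \<in> Div"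
  shows "finite (nongaps P D - nongaps P E)"
    and "int (card (nongaps P D - nongaps P E)) - int (card (nongaps P E - nongaps P D)) = deg D - deg E"
proof -
  obtain \<gamma> where \<gamma>: "\<And>D. D \<in> Div \<Longrightarrow> \<exists>a0 b0. \<forall>a\<le>a0. \<forall>b\<ge>b0. nongaps P D \<subseteq> {a<..} \<and>
     {b<..} \<subseteq> nongaps P D \<and> int (card (nongaps P D \<inter> {a<..b})) = deg D + b - \<gamma>"
    using nongaps_asymptotic by blast
  obtain a1 b1 where 1: "\<And>a b. a \<le> a1 \<Longrightarrow> b \<ge> b1 \<Longrightarrow> nongaps P D \<subseteq> {a<..} \<and>
     {b<..} \<subseteq> nongaps P D \<and> int (card (nongaps P D \<inter> {a<..b})) = deg D + b - \<gamma>"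
    using \<gamma>[OF D] by blast
  obtain a2 b2 where 2: "\<And>a b. a \<le> a2 \<Longrightarrow> b \<ge> b2 \<Longrightarrow> nongaps P E \<subseteq> {a<..} \<and>
     {b<..} \<subseteq> nongaps P E \<and> int (card (nongaps P E \<inter> {a<..b})) = deg E + b - \<gamma>"
    using \<gamma>[OF E] by blast
  define a where "a = min a1 a2"
  define b where "b = max b1 b2"
  let ?X = "nongaps P D" and ?Y = "nongaps P E"
  have X: "?X \<subseteq> {a<..}" "{b<..} \<subseteq> ?X" "int (card (?X \<inter> {a<..b})) = deg D + b - \<gamma>"
    using 1[of a b] by (auto simp: a_def b_def)
  have Y: "?Y \<subseteq> {a<..}" "{b<..} \<subseteq> ?Y" "int (card (?Y \<inter> {a<..b})) = deg E + b - \<gamma>"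
    using 2[of a b] by (auto simp: a_def b_def)
  have XY: "?X - ?Y = (?X \<inter> {a<..b}) - (?Y \<inter> {a<..b})" "?Y - ?X = (?Y \<inter> {a<..b}) - (?X \<inter> {a<..b})"
    using X(1,2) Y(1,2) by force+
  then show "finite (?X - ?Y)"
    by simp
  have card_diff: "card (S - T) + card (S \<inter> T) = card S" if "finite S" for S T :: "int set"
    using that card_Diff_subset_Int[of S T] card_mono[of S "S \<inter> T"] by simp
  let ?S = "?X \<inter> {a<..b}" and ?T = "?Y \<inter> {a<..b}"
  have "card (?X - ?Y) + card (?S \<inter> ?T) = card ?S"
    unfolding XY by (rule card_diff) simp
  moreover have "card (?Y - ?X) + card (?S \<inter> ?T) = card ?T"
    unfolding XY Int_commute[of ?S] by (rule card_diff) simp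
  ultimately show "int (card (?X - ?Y)) - int (card (?Y - ?X)) = deg D - deg E"
    using X(3) Y(3) by linarith
qed


section \<open>Divisor classes\<close>

lemma equiv_lin_equiv: "equiv Div (lin_equiv \<iota>)"
proof (rule equivI)
  show "lin_equiv \<iota> \<subseteq> Div \<times> Div"
    by (auto simp: lin_equiv_def)
  show "refl_on Div (lin_equiv \<iota>)"
    by (auto simp: refl_on_def lin_equiv_def v_1 intro!: exI[of _ 1])
  show "sym (lin_equiv \<iota>)"
  proof (rule symI)
    fix D E assume "(D, E) \<in> lin_equiv \<iota>"
    then obtain f where "D \<in> Div" "E \<in> Div" "f \<noteq> 0" "\<forall>v\<in>points \<iota>. coef (D - E) v = v f"
      by (auto simp: lin_equiv_def)
    then show "(E, D) \<in> lin_equiv \<iota>"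
      unfolding lin_equiv_def
      by (auto intro!: exI[of _ "inverse f"] simp: v_inverse lookup_minus)
  qed
  show "trans (lin_equiv \<iota>)"
  proof (rule transI)
    fix D E F assume "(D, E) \<in> lin_equiv \<iota>" "(E, F) \<in> lin_equiv \<iota>"
    then obtain f g where *: "D \<in> Div" "E \<in> Div" "F \<in> Div" "f \<noteq> 0" "g \<noteq> 0"
      "\<forall>v\<in>points \<iota>. coef (D - E) v = v f" "\<forall>v\<in>points \<iota>. coef (E - F) v = v g"
      by (auto simp: lin_equiv_def)
    have "coef (D - F) v = v (f * g)" if v: "v \<in> points \<iota>" for v
      using bspec[OF *(6) v] bspec[OF *(7) v] *(4,5) v by (simp add: v_mult lookup_minus)
    then show "(D, F) \<in> lin_equiv \<iota>"
      unfolding lin_equiv_def using * by (auto intro!: exI[of _ "f * g"])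
  qed
qed

lemma divisor_class_eqD:
  assumes "A \<in> Div" "B \<in> Div" "divisor_class \<iota> A = divisor_class \<iota> B"
  obtains f where "f \<noteq> 0" "\<And>v. v \<in> points \<iota> \<Longrightarrow> coef A v = coef B v + v f"
proof -
  have "(A, B) \<in> lin_equiv \<iota>"
    using assms eq_equiv_class_iff[OF equiv_lin_equiv] by (simp add: divisor_class_def)
  then show thesis
    using that by (auto simp: lin_equiv_def lookup_minus diff_eq_eq add.commute)
qed

lemma degree_divisor_class:
  assumes "A \<in> Div" "B \<in> Div" "divisor_class \<iota> A = divisor_class \<iota> B"
  shows "deg A = deg B"
proof -
  obtain f where "f \<noteq> 0" "\<And>v. v \<in> points \<iota> \<Longrightarrow> coef A v = coef B v + v f"
    using divisor_class_eqD[OF assms] by blast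
  then have "deg (A - B) = 0"
    using assms by (intro degree_principal[of _ f] divisors_diff) (auto simp: lookup_minus)
  then show ?thesis
    by simp
qed

text \<open>The shift by \<open>C\<close> lets one lemma cover both conditions in
  \<open>Gamma_PC\<close>; \<open>C = 0\<close> is the plain invariance of \<open>nongap\<close> on
  classes.\<close>

lemma nongap_divisor_class:
  assumes "A \<in> Div" "B \<in> Div" "divisor_class \<iota> A = divisor_class \<iota> B" "C \<in> Div" "nongap P (B - C)"
  shows "nongap P (A - C)"
proof -
  obtain f where "f \<noteq> 0" "\<And>v. v \<in> points \<iota> \<Longrightarrow> coef A v = coef B v + v f"
    using divisor_class_eqD[OF assms(1-3)] by blast
  then show ?thesis
    by (intro nongap_linear_equivalent[OF P_point assms(5), of f]) (simp_all add: lookup_minus)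
qed

lemma Gamma_P_iff: "A \<in> Div \<Longrightarrow> divisor_class \<iota> A \<in> Gamma_P \<iota> P \<longleftrightarrow> nongap P A"
  using nongap_divisor_class[of A _ 0]
  by (auto simp: Gamma_P_def nongap_def[symmetric] divisors_0)

lemma Gamma_PC_iff:
  assumes "A \<in> Div" "C \<in> Div"
  shows "divisor_class \<iota> A \<in> Gamma_PC \<iota> P C \<longleftrightarrow> nongap P A \<and> nongap P (A - C)"
proof
  assume "divisor_class \<iota> A \<in> Gamma_PC \<iota> P C"
  then obtain B where "B \<in> Div" "divisor_class \<iota> A = divisor_class \<iota> B" "nongap P B" "nongap P (B - C)"
    using assms by (auto simp: Gamma_PC_def Gamma_P_iff divisors_diff)
  then show "nongap P A \<and> nongap P (A - C)"
    using nongap_divisor_class[of A B C] nongap_divisor_class[of A B 0] assms by (simp add: divisors_0)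
next
  assume "nongap P A \<and> nongap P (A - C)"
  then show "divisor_class \<iota> A \<in> Gamma_PC \<iota> P C"
    using assms by (auto simp: Gamma_PC_def Gamma_P_iff divisors_diff)
qed

text \<open>The class of \<open>B + iP\<close> has degree \<open>deg B + i\<close> because
  \<open>P\<close> is rational, so distinct \<open>i\<close> give distinct classes and the classes
  can be counted by integers.\<close>

lemma Delta_P_card:
  assumes B: "B \<in> Div" and C: "C \<in> Div"
  shows "finite (Delta_P \<iota> P B C)" "card (Delta_P \<iota> P B C) = card (nongaps P B - nongaps P (B - C))"
proof -
  let ?f = "\<lambda>i. divisor_class \<iota> (B + pt P i)"
  have "B - C \<in> Div"
    using B C by (rule divisors_diff)
  then have eq: "Delta_P \<iota> P B C = ?f ` (nongaps P B - nongaps P (B - C))"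
    using B by (auto simp: Delta_P_def nongaps_def Gamma_P_iff divisors_pt_P)
  have "inj ?f"
  proof (rule injI)
    fix i j assume "?f i = ?f j"
    then have "deg (B + pt P i) = deg (B + pt P j)"
      using degree_divisor_class divisors_pt_P[OF B] by blast
    then show "i = j"
      by simp
  qed
  then show "card (Delta_P \<iota> P B C) = card (nongaps P B - nongaps P (B - C))"
    unfolding eq by (intro card_image) (rule inj_on_subset, auto)
  show "finite (Delta_P \<iota> P B C)"
    unfolding eq using card_nongaps_diff(1)[OF B \<open>B - C \<in> Div\<close>] by simp
qed

text \<open>Since \<open>(B - C) - (- C) = B\<close>, the second set counts the opposite difference
  of \<open>nongaps\<close>.\<close>

lemma Delta_P_diff:
  assumes B: "B \<in> Div" and C: "C \<in> Div"
  shows "int (card (Delta_P \<iota> P B C)) - int (card (Delta_P \<iota> P (B - C) (- C))) = deg C"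
proof -
  have "B - C \<in> Div" "- C \<in> Div"
    using B C by (auto intro: divisors_intros)
  then show ?thesis
    using Delta_P_card(2)[OF B C] Delta_P_card(2)[of "B - C" "- C"]
      card_nongaps_diff(2)[OF B \<open>B - C \<in> Div\<close>] by simp
qed

text \<open>
  Adding \<open>A - C \<in> \<Gamma>\<^sub>P\<close> shows \<open>\<Delta>\<^sub>P(B,C) \<subseteq> \<Delta>\<^sub>P(B,A)\<close>, and the latter set has exactly
  \<open>deg A\<close> elements because \<open>\<Delta>\<^sub>P(B-A,-A)\<close> is empty for \<open>A \<in> \<Gamma>\<^sub>P\<close>.
\<close>

lemma card_Delta_P_le:
  assumes B: "B \<in> Div" and C: "C \<in> Div" and A: "A \<in> Div" "nongap P A" "nongap P (A - C)"
  shows "int (card (Delta_P \<iota> P B C)) \<le> deg A"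
proof -
  have BC: "B - C \<in> Div" "B - A \<in> Div"
    using B C A by (auto intro: divisors_diff)
  have "nongaps P B - nongaps P (B - C) \<subseteq> nongaps P B - nongaps P (B - A)"
  proof -
    have "nongap P (B - C + pt P i)" if "nongap P (B - A + pt P i)" for i
      using nongap_add[OF P_point that A(3)] by (simp add: algebra_simps)
    then show ?thesis
      by (auto simp: nongaps_def)
  qed
  then have "card (nongaps P B - nongaps P (B - C)) \<le> card (nongaps P B - nongaps P (B - A))"
    using card_nongaps_diff(1)[OF B BC(2)] by (rule card_mono[rotated])
  moreover have "nongaps P (B - A) - nongaps P B = {}"
  proof -
    have "nongap P (B + pt P i)" if "nongap P (B - A + pt P i)" for i
      using nongap_add[OF P_point that A(2)] by (simp add: algebra_simps)
    then show ?thesis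
      by (auto simp: nongaps_def)
  qed
  then have "card (nongaps P (B - A) - nongaps P B) = 0"
    by (simp only: card.empty)
  ultimately show ?thesis
    using card_nongaps_diff(2)[OF B BC(2)] Delta_P_card(2)[OF B C] by simp
qed

section \<open>The minimum in \<open>gamma_P\<close>\<close>

definition Gamma_degrees :: "'a divisor \<Rightarrow> int set" where
  "Gamma_degrees C = {deg A |A. A \<in> Div \<and> nongap P A \<and> nongap P (A - C)}"

lemma gamma_P_eq: "C \<in> Div \<Longrightarrow> gamma_P \<iota> P C = (LEAST d. d \<in> Gamma_degrees C)"
proof -
  assume C: "C \<in> Div"
  have "{deg A |A. A \<in> Div \<and> divisor_class \<iota> A \<in> Gamma_PC \<iota> P C} = Gamma_degrees C"
    unfolding Gamma_degrees_def using Gamma_PC_iff[OF _ C] by blast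
  then show ?thesis
    unfolding gamma_P_def by simp
qed

text \<open>For large \<open>i\<close> both \<open>iP\<close> and \<open>iP - C\<close> are beyond
  their last gaps.\<close>

lemma Gamma_degrees_nonempty:
  assumes C: "C \<in> Div"
  shows "Gamma_degrees C \<noteq> {}"
proof -
  obtain \<gamma> where \<gamma>: "\<And>D. D \<in> Div \<Longrightarrow> \<exists>a0 b0. \<forall>a\<le>a0. \<forall>b\<ge>b0. nongaps P D \<subseteq> {a<..} \<and>
     {b<..} \<subseteq> nongaps P D \<and> int (card (nongaps P D \<inter> {a<..b})) = deg D + b - \<gamma>"
    using nongaps_asymptotic by blast
  have "\<exists>b. {b<..} \<subseteq> nongaps P D" if "D \<in> Div" for D
    using \<gamma>[OF that] by (meson order_refl)
  then obtain b1 b2 where b: "{b1<..} \<subseteq> nongaps P 0" "{b2<..} \<subseteq> nongaps P (- C)"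
    using C divisors_0 divisors_minus by metis
  define i where "i = max b1 b2 + 1"
  have "i \<in> nongaps P 0" "i \<in> nongaps P (- C)"
    using b by (auto simp: i_def subset_iff)
  then have "nongap P (pt P i)" "nongap P (pt P i - C)"
    by (auto simp: nongaps_def)
  then show ?thesis
    using divisors_pt[OF P_point, of i] by (auto simp: Gamma_degrees_def)
qed

lemma gamma_P_in:
  assumes C: "C \<in> Div"
  shows "gamma_P \<iota> P C \<in> Gamma_degrees C" "\<And>d. d \<in> Gamma_degrees C \<Longrightarrow> gamma_P \<iota> P C \<le> d"
proof -
  \<comment> \<open>On \<open>int\<close> a least element requires a lower bound for the set; here
    \<open>card_Delta_P_le\<close> at \<open>B = 0\<close> bounds every degree below by a
    cardinality.\<close>
  have nonneg: "d \<ge> 0" if "d \<in> Gamma_degrees C" for d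
    using that card_Delta_P_le[OF divisors_0 C] by (fastforce simp: Gamma_degrees_def)
  obtain d0 where d0: "d0 \<in> Gamma_degrees C"
    using Gamma_degrees_nonempty[OF C] by blast
  obtain d where d: "d \<in> Gamma_degrees C" "\<And>e. e \<in> Gamma_degrees C \<Longrightarrow> nat d \<le> nat e"
    using ex_has_least_nat[of "\<lambda>d. d \<in> Gamma_degrees C" d0 nat] d0 by blast
  have le: "d \<le> e" if "e \<in> Gamma_degrees C" for e
    using d(2)[OF that] nonneg[OF that] nonneg[OF d(1)] by simp
  then have "gamma_P \<iota> P C = d"
    unfolding gamma_P_eq[OF C] using d(1) by (intro Least_equality) auto
  then show "gamma_P \<iota> P C \<in> Gamma_degrees C" "\<And>d. d \<in> Gamma_degrees C \<Longrightarrow> gamma_P \<iota> P C \<le> d"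
    using d(1) le by auto
qed

lemma gamma_P_ge:
  assumes "B \<in> Div" "C \<in> Div"
  shows "gamma_P \<iota> P C \<ge> int (card (Delta_P \<iota> P B C))"
  using gamma_P_in(1)[OF assms(2)] card_Delta_P_le[OF assms] by (auto simp: Gamma_degrees_def)

text \<open>Replacing \<open>A\<close> by \<open>A - C\<close> exchanges the two conditions, as
  \<open>(A - C) - (- C) = A\<close>.\<close>

lemma Gamma_degrees_minus:
  assumes "C \<in> Div" "d \<in> Gamma_degrees C"
  shows "d - deg C \<in> Gamma_degrees (- C)"
proof -
  obtain A where A: "A \<in> Div" "nongap P A" "nongap P (A - C)" "d = deg A"
    using assms by (auto simp: Gamma_degrees_def)
  then show ?thesis
    unfolding Gamma_degrees_def using assms(1)
    by (intro CollectI exI[of _ "A - C"]) (auto intro: divisors_diff)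
qed

lemma gamma_P_minus:
  assumes C: "C \<in> Div"
  shows "gamma_P \<iota> P (- C) = gamma_P \<iota> P C - deg C"
proof -
  have C': "- C \<in> Div"
    using C by (rule divisors_minus)
  have "gamma_P \<iota> P C - deg C \<in> Gamma_degrees (- C)" "gamma_P \<iota> P (- C) + deg C \<in> Gamma_degrees C"
    using Gamma_degrees_minus[OF C gamma_P_in(1)[OF C]]
      Gamma_degrees_minus[OF C' gamma_P_in(1)[OF C']] by simp_all
  then show ?thesis
    using gamma_P_in(2)[OF C] gamma_P_in(2)[OF C'] by force
qed

end

text \<open>The equality of the two slacks is the strong form of the equivalence; it combines
  \<open>gamma_P_minus\<close> with \<open>Delta_P_diff\<close>. Finiteness is stated because
  \<open>card\<close> is 0 on infinite sets.\<close>

theorem corollary5p5: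
  fixes \<iota> :: "'k::{field,finite} \<Rightarrow> 'a::field"
    and P :: "'a point" and B C :: "'a divisor"
  assumes "curve \<iota>"
    and "P \<in> rational_points \<iota>"
    and "C \<in> divisors \<iota>"
    and "B \<in> divisors \<iota>"
  shows "finite (Delta_P \<iota> P B C) \<and> finite (Delta_P \<iota> P (B - C) (- C)) \<and>
         gamma_P \<iota> P C \<ge> int (card (Delta_P \<iota> P B C)) \<and>
         gamma_P \<iota> P (- C) \<ge> int (card (Delta_P \<iota> P (B - C) (- C))) \<and>
         (gamma_P \<iota> P C \<ge> int (card (Delta_P \<iota> P B C)) \<longleftrightarrow>
            gamma_P \<iota> P (- C) \<ge> int (card (Delta_P \<iota> P (B - C) (- C)))) \<and>
         gamma_P \<iota> P C - int (card (Delta_P \<iota> P B C)) =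
           gamma_P \<iota> P (- C) - int (card (Delta_P \<iota> P (B - C) (- C)))"
proof -
  interpret pointed_function_field \<iota> P
    using assms by unfold_locales
  have "B - C \<in> divisors \<iota>" "- C \<in> divisors \<iota>"
    using assms by (auto intro: divisors_intros)
  then show ?thesis
    using assms Delta_P_card(1)[of B C] Delta_P_card(1)[of "B - C" "- C"] gamma_P_ge[of B C]
      gamma_P_ge[of "B - C" "- C"] gamma_P_minus[of C] Delta_P_diff[of B C] by auto
qed

end
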